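(* Let $f\in XDBP$. With the canonical identification of the set $E^n$ of edges of $\mathbf{D}_{f^{\circ n}}$ with the $n$-fold Cartesian product $E\times\cdots\times E$ via itineraries, the monodromy generators $\sigma_0^n,\sigma_1^n$ of $f^{\circ n}$ satisfy, for all $n\ge2$ and all $(\epsilon_{i_1},\dots,\epsilon_{i_n})\in E^n$, $$\sigma_1^n(\epsilon_{i_1},\epsilon_{i_2},\dots,\epsilon_{i_n})=(\epsilon_{i_1},\epsilon_{i_2},\dots,\epsilon_{i_{n-1}},\sigma_1(\epsilon_{i_n})),$$ and $$\sigma_0^n(\epsilon_{i_1},\epsilon_{i_2},\dots,\epsilon_{i_n})=\begin{cases}(\epsilon_{i_1},\epsilon_{i_2},\dots,\epsilon_{i_{n-1}},\sigma_0(\epsilon_{i_n}))&\text{if }\epsilon_{i_n}\neq\epsilon_0,\epsilon_1,\\(\sigma_1^{n-1}(\epsilon_{i_1},\dots,\epsilon_{i_{n-1}}),\epsilon_{i_n})&\text{if }\epsilon_{i_n}=\epsilon_1,\\(\sigma_0^{n-1}(\epsilon_{i_1},\dots,\epsilon_{i_{n-1}}),\epsilon_{i_n})&\text{if }\epsilon_{i_n}=\epsilon_0,\end{cases}$$ where $\sigma_0=\sigma_0^1$ and $\sigma_1=\sigma_1^1$.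
   Context: Fix an embedding $\overline{\mathbb{Q}}\subset\mathbb{C}$. For a polynomial $f$, $C_f$ is its set of critical points in $\mathbb{C}$ and $P_f=\overline{\bigcup_{n>0}f^{\circ n}(C_f)}$. $DBP$ is the set of polynomials $f\in\overline{\mathbb{Q}}[z]$ of degree at least $3$ whose critical values lie in $\{0,1\}$, having local degree exactly $2$ at every point of $f^{-1}(1)$, and with $P_f\subset\{0,1\}$. $XDBP$ is the set of $f\in DBP$ with $f(0)=f(1)=0$ and local degree one at both $0$ and $1$. $XDBP$ is closed under iteration. Let $f\in XDBP$ have degree $d$. **Partition.** By holomorphic dynamics (may be assumed) there are disjoint arcs $\gamma_0,\gamma_1$ (closed external rays, including landing points) joining $0$ and $1$ respectively to $\infty$ with $f(\gamma_0)=\gamma_0$ and $f(\gamma_1)=\gamma_0$. Put $U^0=\mathbb{C}\setminus(\gamma_0\cup\gamma_1)$, which is simply connected and contains no critical values of any $f^{\circ n}$, and inductively $U^n=f^{-1}(U^{n-1})$ for $n\ge1$. Then $U^n\subset U^{n-1}$, and each component of $U^n$ maps biholomorphically by $f$ onto a component of $U^{n-1}$; $U^n$ has $d^n$ components. **Dessins.** Choose an arc $\lambda$ from $0$ to $1$ whose interior lies in $U^0$, passing through a (rational) basepoint $b\in(0,1)$. The dessin $\mathbf{D}_{f^{\circ n}}$ is the planar tree $(f^{\circ n})^{-1}(\lambda)$, with black vertices the preimages of $0$, white vertices the preimages of $1$, and edges the lifts of $\lambda$. Edges of $\mathbf{D}_{f^{\circ n}}$, points of $f^{-n}(b)=(f^{\circ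 n})^{-1}(b)$ and components of $U^n$ are canonically identified: each edge contains exactly one point of $f^{-n}(b)$, and each component of $U^n$ contains exactly one such point. $E$ denotes the set of edges of $\mathbf{D}_f$, equivalently of components of $U^1$. Since $f$ has local degree one at $0$ and $1$, each of $0,1$ is incident to exactly one edge of $\mathbf{D}_f$: $\epsilon_0$ is the edge incident to $0$ and $\epsilon_1$ the edge incident to $1$. **Itineraries.** An edge $X$ of $\mathbf{D}_{f^{\circ n}}$ (or the corresponding point of $f^{-n}(b)$) is identified with $(\epsilon_{i_1},\dots,\epsilon_{i_n})\in E\times\cdots\times E$, where $\epsilon_{i_k}$ is the component of $U^1$ containing $f^{\circ(k-1)}(X)$ (for the edge, its interior), $k=1,\dots,n$. This is a bijection onto the $n$-fold product. **Monodromy generators.** For $j\in\{0,1\}$ let $\alpha_j\in\pi_1(\mathbb{C}\setminus\{0,1\},b)$ be the class of the loop which follows $\lambda$ from $b$ until near $j$, goes once counterclockwise around $j$ on a small circle, and returns along $\lambda$. $\sigma_j^n$ is the permutation of $f^{-n}(b)$ (hence of $E^n$) sending $x$ to the endpoint of the lift under $f^{\circ n}$ of $\alpha_j$ starting at $x$. Equivalently, $\sigma_0^n$ rotates edges of $\mathbf{D}_{f^{\circ n}}$ counterclockwise about black vertices, and $\sigma_1^n$ about white vertices. The monodromy group $\mathrm{Mon}(f^{\circ n})$ of $f^{\circ n}$ is the group they generate. *)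

theory Defs
  imports "HOL-Complex_Analysis.Complex_Analysis"
begin

definition local_degree :: "complex poly \<Rightarrow> complex \<Rightarrow> nat" where
  "local_degree f z = order z (f - [:poly f z:])"

definition critical_points :: "complex poly \<Rightarrow> complex set" where
  "critical_points f = {z. poly (pderiv f) z = 0}"

definition postcritical_set :: "complex poly \<Rightarrow> complex set" where
  "postcritical_set f = closure (\<Union>n\<in>{0<..}. (poly f ^^ n) ` critical_points f)"

definition DBP :: "complex poly set" where
  "DBP = {f. (\<forall>i. algebraic (coeff f i)) \<and> degree f \<ge> 3 \<and>
             poly f ` critical_points f \<subseteq> {0, 1} \<and>
             (\<forall>z. poly f z = 1 \<longrightarrow> local_degree f z = 2) \<and>
             postcritical_set f \<subseteq> {0, 1}}"

definition XDBP :: "complex poly set" where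
  "XDBP = {f \<in> DBP. poly f 0 = 0 \<and> poly f 1 = 0 \<and> local_degree f 0 = 1 \<and> local_degree f 1 = 1}"

definition filled_julia :: "complex poly \<Rightarrow> complex set" where
  "filled_julia f = {z. bounded (range (\<lambda>n. (poly f ^^ n) z))}"

text \<open>The inverse of a Boettcher coordinate on the whole basin of infinity; it exists exactly when
  the filled Julia set is connected, and it is then unique up to precomposition with a rotation by
  a \<open>(degree f - 1)\<close>-th root of unity.\<close>

definition boettcher_param :: "complex poly \<Rightarrow> (complex \<Rightarrow> complex) \<Rightarrow> bool" where
  "boettcher_param f \<psi> \<longleftrightarrow>
     \<psi> holomorphic_on {w. 1 < norm w} \<and>
     bij_betw \<psi> {w. 1 < norm w} (- filled_julia f) \<and>
     (\<forall>w. 1 < norm w \<longrightarrow> poly f (\<psi> w) = \<psi> (w ^ degree f))"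

text \<open>\<open>\<gamma>\<close> is an external ray of \<open>f\<close> that lands at \<open>z\<close>, together with \<open>z\<close>.\<close>

definition closed_external_ray :: "complex poly \<Rightarrow> complex \<Rightarrow> complex set \<Rightarrow> bool" where
  "closed_external_ray f z \<gamma> \<longleftrightarrow>
     (\<exists>\<psi> \<theta>. boettcher_param f \<psi> \<and>
        ((\<lambda>r. \<psi> (of_real r * cis \<theta>)) \<longlongrightarrow> z) (at_right 1) \<and>
        \<gamma> = insert z ((\<lambda>r. \<psi> (of_real r * cis \<theta>)) ` {1<..}))"

primrec U :: "complex poly \<Rightarrow> complex set \<Rightarrow> complex set \<Rightarrow> nat \<Rightarrow> complex set" where
  "U f \<gamma>0 \<gamma>1 0 = - (\<gamma>0 \<union> \<gamma>1)"
| "U f \<gamma>0 \<gamma>1 (Suc n) = poly f -` U f \<gamma>0 \<gamma>1 n"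

definition is_lift :: "(complex \<Rightarrow> complex) \<Rightarrow> (real \<Rightarrow> complex) \<Rightarrow> (real \<Rightarrow> complex) \<Rightarrow> bool" where
  "is_lift p \<alpha> g \<longleftrightarrow> path g \<and> (\<forall>t\<in>{0..1}. p (g t) = \<alpha> t)"

definition dessin_edges :: "complex poly \<Rightarrow> (real \<Rightarrow> complex) \<Rightarrow> nat \<Rightarrow> complex set set" where
  "dessin_edges f \<Lambda> n = {path_image g | g. is_lift (poly f ^^ n) \<Lambda> g}"

text \<open>The edge without its black and white end vertices.\<close>

definition edge_interior :: "complex poly \<Rightarrow> nat \<Rightarrow> complex set \<Rightarrow> complex set" where
  "edge_interior f n X = {x \<in> X. (poly f ^^ n) x \<notin> {0, 1}}"

definition incident_edge :: "complex poly \<Rightarrow> (real \<Rightarrow> complex) \<Rightarrow> complex \<Rightarrow> complex set" where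
  "incident_edge f \<Lambda> v = (THE e. e \<in> dessin_edges f \<Lambda> 1 \<and> v \<in> e)"

text \<open>Edges of the dessin of \<open>f\<close> stand for the components of \<open>U f \<gamma>0 \<gamma>1 1\<close> that contain their
  interiors; \<open>k\<close> below is one less than the position in the itinerary.\<close>

definition itinerary ::
    "complex poly \<Rightarrow> complex set \<Rightarrow> complex set \<Rightarrow> (real \<Rightarrow> complex) \<Rightarrow> nat \<Rightarrow>
     complex set \<Rightarrow> complex set list" where
  "itinerary f \<gamma>0 \<gamma>1 \<Lambda> n X =
     map (\<lambda>k. THE e. e \<in> dessin_edges f \<Lambda> 1 \<and>
            (\<exists>C \<in> components (U f \<gamma>0 \<gamma>1 1).
               edge_interior f 1 e \<subseteq> C \<and> (poly f ^^ k) ` edge_interior f n X \<subseteq> C))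
       [0..<n]"

text \<open>Follow \<open>\<Lambda>\<close> from \<open>\<Lambda> s\<close> to \<open>\<Lambda> t\<close>, go once counterclockwise around the circle with centre \<open>j\<close>
  through \<open>\<Lambda> t\<close>, and return along \<open>\<Lambda>\<close>.\<close>

definition lasso :: "(real \<Rightarrow> complex) \<Rightarrow> complex \<Rightarrow> real \<Rightarrow> real \<Rightarrow> real \<Rightarrow> complex" where
  "lasso \<Lambda> j s t =
     subpath s t \<Lambda> +++ (\<lambda>u. j + (\<Lambda> t - j) * exp (2 * of_real pi * \<i> * of_real u)) +++ subpath t s \<Lambda>"

text \<open>The class of the loop around \<open>j\<close> in the fundamental group of the plane minus \<open>0\<close> and \<open>1\<close> with
  base point \<open>b\<close>, for an arc \<open>\<Lambda>\<close> from \<open>0\<close> to \<open>1\<close> through \<open>b\<close> and \<open>j = 0\<close> or \<open>j = 1\<close> (so that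
  \<open>\<Lambda> j = j\<close>). The homotopy class of the lasso does not depend on \<open>t\<close> once \<open>t\<close> is near \<open>j\<close>.\<close>

definition loop_class :: "(real \<Rightarrow> complex) \<Rightarrow> complex \<Rightarrow> real \<Rightarrow> (real \<Rightarrow> complex) set" where
  "loop_class \<Lambda> b j =
     {\<alpha>. \<exists>s\<in>{0..1}. \<Lambda> s = b \<and>
          (\<forall>\<^sub>F t in at j within {0..1}. homotopic_paths (- {0, 1}) \<alpha> (lasso \<Lambda> (of_real j) s t))}"

definition monodromy :: "(complex \<Rightarrow> complex) \<Rightarrow> (real \<Rightarrow> complex) \<Rightarrow> complex \<Rightarrow> complex" where
  "monodromy p \<alpha> x = (THE y. \<exists>g. is_lift p \<alpha> g \<and> pathstart g = x \<and> pathfinish g = y)"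

text \<open>The monodromy permutation transported from the fibre of \<open>poly f ^^ n\<close> over \<open>b\<close> to the edges
  (each edge contains exactly one point of the fibre), and from there to itineraries.\<close>

definition edge_monodromy ::
    "complex poly \<Rightarrow> (real \<Rightarrow> complex) \<Rightarrow> complex \<Rightarrow> (real \<Rightarrow> complex) \<Rightarrow> nat \<Rightarrow>
     complex set \<Rightarrow> complex set" where
  "edge_monodromy f \<Lambda> b \<alpha> n X =
     (THE Y. Y \<in> dessin_edges f \<Lambda> n \<and>
        monodromy (poly f ^^ n) \<alpha> (THE x. x \<in> X \<and> (poly f ^^ n) x = b) \<in> Y)"

definition itinerary_monodromy ::
    "complex poly \<Rightarrow> complex set \<Rightarrow> complex set \<Rightarrow> (real \<Rightarrow> complex) \<Rightarrow> complex \<Rightarrow>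
     (real \<Rightarrow> complex) \<Rightarrow> nat \<Rightarrow> complex set list \<Rightarrow> complex set list" where
  "itinerary_monodromy f \<gamma>0 \<gamma>1 \<Lambda> b \<alpha> n es =
     itinerary f \<gamma>0 \<gamma>1 \<Lambda> n
       (edge_monodromy f \<Lambda> b \<alpha> n (the_inv_into (dessin_edges f \<Lambda> n) (itinerary f \<gamma>0 \<gamma>1 \<Lambda> n) es))"

end

theory Submission
  imports Defs "HOL-Computational_Algebra.Fundamental_Theorem_Algebra"
begin

text \<open>Factor \<open>f\<^sup>n = f \<circ> f\<^sup>n\<^sup>-\<^sup>1\<close>. The lift of a loop \<open>\<alpha>\<close> under \<open>f\<^sup>n\<close> from \<open>x\<close> is the lift under \<open>f\<^sup>n\<^sup>-\<^sup>1\<close> of the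
  lift of \<open>\<alpha>\<close> under \<open>f\<close> from \<open>y = f\<^sup>n\<^sup>-\<^sup>1 x\<close>. The latter lift determines the last entry of the
  itinerary. If it can be deformed into \<open>U\<^sup>0\<close>, its lift under \<open>f\<^sup>n\<^sup>-\<^sup>1\<close> stays in one component of
  \<open>U\<^sup>n\<^sup>-\<^sup>1\<close> and the remaining entries do not change; this happens around white vertices, because a small
  loop around \<open>1\<close> misses \<open>\<gamma>0\<close> and \<open>f\<^sup>-\<^sup>1 (\<gamma>0)\<close> contains both rays, and around the black vertices
  other than \<open>0\<close> and \<open>1\<close>, which lie in \<open>U\<^sup>0\<close>. Around a black vertex \<open>v \<in> {0, 1}\<close> the lift is again a
  small loop around \<open>v\<close>, carried along the edge. In the plane minus the ray at \<open>1 - v\<close>, punctured at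
  \<open>v\<close>, the fundamental group is abelian, so this loop is \<open>\<tau> \<alpha>\<^sub>v \<tau>\<^sup>-\<^sup>1\<close> for a path \<open>\<tau>\<close> in \<open>U\<^sup>0\<close> from \<open>y\<close>
  to \<open>b\<close>, which acts on the first \<open>n - 1\<close> entries as \<open>\<alpha>\<^sub>v\<close>.\<close>

section \<open>Polynomials as branched coverings\<close>

text \<open>Two coverings carry the argument: \<open>F n\<close> over the plane minus {0, 1}, where
  loops are lifted, and f from \<open>U1\<close> to the simply connected \<open>U0\<close>, which
  has a global inverse branch through every point of \<open>U1\<close> and so lets edges name
  components. The second needs the topology of the rays. A ray is given only through a Boettcher
  parametrization, so its closedness, its unboundedness and the simple connectivity of complements
  are derived from the dynamics of f near infinity. Edges, on the other hand, end over 0 and 1,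
  where iterates may branch and no covering argument applies; there the limits come from the
  separation of the finitely many preimages. For a lift around 0 or 1 it must also be seen that it
  runs once and counterclockwise: this is read off from the linear approximation of f at the vertex,
  whose relative error of at most 1/2 allows a straight-line homotopy to a genuine circle.\<close>

lemma lead_coeff_mult_power_le_norm_poly:
  fixes p :: "complex poly"
  assumes "0 \<le> \<epsilon>" and far: "\<And>v. poly p v = 0 \<Longrightarrow> \<epsilon> \<le> dist z v"
  shows "norm (lead_coeff p) * \<epsilon> ^ degree p \<le> norm (poly p z)"
proof (cases "p = 0")
  case False
  obtain A where A: "size A = degree p" "p = smult (lead_coeff p) (\<Prod>x\<in>#A. [:-x, 1:])"
    using alg_closed_imp_factorization[OF False] by blast
  have pz: "poly p w = lead_coeff p * (\<Prod>x\<in>#A. w - x)" for w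
  proof -
    have "poly (\<Prod>x\<in>#A. [:-x, 1:]) w = (\<Prod>x\<in>#A. w - x)"
      by (simp add: poly_prod_mset image_mset.compositionality comp_def)
    then show ?thesis by (metis A(2) poly_smult)
  qed
  have root: "poly p x = 0" if "x \<in># A" for x
    unfolding pz using that by (auto simp: prod_mset_zero_iff)
  \<comment> \<open>Induction over sub-multisets of the roots, so that multiplicities count and the
    bound for all of \<open>A\<close> has exponent \<open>degree p\<close>.\<close>
  have "\<epsilon> ^ size B \<le> norm (\<Prod>x\<in>#B. z - x)" if "B \<subseteq># A" for B
    using that
  proof (induction B)
    case (add x B)
    have "\<epsilon> \<le> norm (z - x)"
      using far[OF root[of x]] add.prems mset_subset_eqD[OF add.prems, of x] by (simp add: dist_norm)
    moreover have "\<epsilon> ^ size B \<le> norm (\<Prod>x\<in>#B. z - x)"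
      using add subset_mset.order_trans[of B "add_mset x B" A] by auto
    ultimately show ?case
      using \<open>0 \<le> \<epsilon>\<close> by (simp add: norm_mult mult_mono)
  qed simp
  from this[of A] show ?thesis
    by (subst pz) (simp add: A(1)[symmetric] norm_mult mult_left_mono)
qed simp

lemma degree_diff_const: "degree (p - [:w:]) = degree (p :: complex poly)"
proof (cases "degree p = 0")
  case True
  then obtain a where "p = [:a:]" by (rule degree_eq_zeroE)
  then show ?thesis by simp
next
  case False
  then have "degree (- [:w:] + p) = degree p" by (intro degree_add_eq_right) auto
  then show ?thesis by (metis add.commute diff_conv_add_uminus)
qed

text \<open>The threshold is explicit because p - w splits into linear factors: at distance at least
  \<epsilon> from all its zeros, the norm of p - w is at least
  \<open>norm (lead_coeff p) * \<epsilon> ^ degree p\<close>. This quantitative properness keeps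
  preimages of a small disc close to the fibre.\<close>

lemma poly_near_value_imp_near_preimage:
  fixes p :: "complex poly"
  assumes "degree p > 0" "\<epsilon> > 0"
  obtains \<eta> where "\<eta> > 0"
    "\<And>z. dist (poly p z) w < \<eta> \<Longrightarrow> \<exists>v. poly p v = w \<and> dist z v < \<epsilon>"
proof
  define q where "q = p - [:w:]"
  have q: "degree q = degree p" "lead_coeff q = lead_coeff p"
    using assms by (simp_all add: q_def degree_diff_const coeff_pCons split: nat.splits)
  define \<eta> where "\<eta> = norm (lead_coeff p) * \<epsilon> ^ degree p"
  show "\<eta> > 0"
    using assms by (cases "p = 0") (auto simp: \<eta>_def)
  fix z assume z: "dist (poly p z) w < \<eta>"
  show "\<exists>v. poly p v = w \<and> dist z v < \<epsilon>"
  proof (rule ccontr)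
    assume "\<not> ?thesis"
    then have far: "\<epsilon> \<le> dist z v" if "poly q v = 0" for v
      using that by (force simp: q_def)
    have "\<eta> \<le> norm (poly q z)"
      using lead_coeff_mult_power_le_norm_poly[of \<epsilon> q z] far \<open>\<epsilon> > 0\<close>
      by (metis \<eta>_def q less_imp_le)
    with z show False by (simp add: q_def dist_norm)
  qed
qed

lemma finite_separated:
  fixes S :: "'a::metric_space set"
  assumes "finite S"
  obtains \<delta> where "\<delta> > 0" "\<And>x y. x \<in> S \<Longrightarrow> y \<in> S \<Longrightarrow> x \<noteq> y \<Longrightarrow> \<delta> \<le> dist x y"
proof -
  have "\<forall>x\<in>S. \<exists>d>0. \<forall>y\<in>S. y \<noteq> x \<longrightarrow> d \<le> dist x y"
    using finite_set_avoid[OF assms] by blast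
  then obtain d where d: "\<And>x. x \<in> S \<Longrightarrow> d x > 0 \<and> (\<forall>y\<in>S. y \<noteq> x \<longrightarrow> d x \<le> dist x y)"
    by metis
  show ?thesis
  \<comment> \<open>The added 1 keeps the minimum defined and positive when \<open>S\<close> is
    empty.\<close>
  proof (rule that[of "Min (insert 1 (d ` S))"])
    show "Min (insert 1 (d ` S)) > 0" using assms d by auto
    show "Min (insert 1 (d ` S)) \<le> dist x y" if "x \<in> S" "y \<in> S" "x \<noteq> y" for x y
    proof -
      have "Min (insert 1 (d ` S)) \<le> d x" using assms that by auto
      also have "\<dots> \<le> dist x y" using d that by metis
      finally show ?thesis .
    qed
  qed
qed

lemma finite_poly_fibre: "degree p > 0 \<Longrightarrow> finite {v. poly p v = (w::complex)}"
  using poly_roots_finite[of "p - [:w:]"] by (cases "p = [:w:]") auto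

lemma poly_fibre_separated:
  fixes p :: "complex poly"
  assumes "degree p > 0"
  obtains \<delta> where "\<delta> > 0" "\<And>x y. poly p x = w \<Longrightarrow> poly p y = w \<Longrightarrow> x \<noteq> y \<Longrightarrow> \<delta> \<le> dist x y"
proof (rule finite_separated[OF finite_poly_fibre[OF assms, of w]])
  fix \<delta> :: real
  assume "\<delta> > 0" "\<And>x y. x \<in> {v. poly p v = w} \<Longrightarrow> y \<in> {v. poly p v = w} \<Longrightarrow> x \<noteq> y \<Longrightarrow> \<delta> \<le> dist x y"
  then show ?thesis by (intro that[of \<delta>]) auto
qed

text \<open>Around each of the finitely many points of a fibre p is injective, and small discs there
  are disjoint. The sheets over a neighbourhood \<open>T\<close> of y are these discs cut down to
  the preimage of \<open>T\<close>; the bound on preimages near the fibre ensures that nothing else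
  lies over \<open>T\<close>.\<close>

lemma covering_space_poly:
  fixes p :: "complex poly"
  assumes deg: "degree p > 0" and "open S"
    and noncrit: "\<And>x. poly p x \<in> S \<Longrightarrow> poly (pderiv p) x \<noteq> 0"
  shows "covering_space (poly p -` S) (poly p) S"
proof
  show "continuous_on (poly p -` S) (poly p)" by (intro continuous_intros)
  have "\<exists>x. poly p x = y" for y
    using deg alg_closed_imp_poly_has_root[of "p - [:y:]"]
    by (auto simp: degree_diff_const)
  then show "poly p ` (poly p -` S) = S" by (metis surj_def surj_image_vimage_eq)
next
  fix y assume "y \<in> S"
  define R where "R = {v. poly p v = y}"
  have finR: "finite R" unfolding R_def by (rule finite_poly_fibre[OF deg])
  obtain \<delta> where \<delta>: "\<delta> > 0" "\<And>x y. x \<in> R \<Longrightarrow> y \<in> R \<Longrightarrow> x \<noteq> y \<Longrightarrow> \<delta> \<le> dist x y"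
    using finite_separated[OF finR] by blast
  have "\<exists>r>0. inj_on (poly p) (ball v r)" if "v \<in> R" for v
    using has_complex_derivative_locally_injective[of "poly p" UNIV v] noncrit[of v] that \<open>y \<in> S\<close>
    by (auto simp: R_def holomorphic_intros DERIV_imp_deriv[OF poly_DERIV])
  then obtain r where r: "\<And>v. v \<in> R \<Longrightarrow> r v > 0 \<and> inj_on (poly p) (ball v (r v))"
    by metis
  define \<epsilon> where "\<epsilon> = Min (insert (\<delta> / 2) (r ` R))"
  have \<epsilon>: "\<epsilon> > 0" "\<epsilon> \<le> \<delta> / 2" "\<And>v. v \<in> R \<Longrightarrow> \<epsilon> \<le> r v"
  proof -
    show "\<epsilon> > 0" unfolding \<epsilon>_def using finR \<delta>(1) r by (subst Min_gr_iff) auto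
    show "\<epsilon> \<le> \<delta> / 2" unfolding \<epsilon>_def using finR by (intro Min_le) auto
    show "\<epsilon> \<le> r v" if "v \<in> R" for v unfolding \<epsilon>_def using finR that by (intro Min_le) auto
  qed
  have inj: "inj_on (poly p) (ball v \<epsilon>)" if "v \<in> R" for v
    using r[OF that] \<epsilon>(3)[OF that] by (meson inj_on_subset subset_ball)
  have disj: "ball v \<epsilon> \<inter> ball w \<epsilon> = {}" if "v \<in> R" "w \<in> R" "v \<noteq> w" for v w
    using \<delta>(2)[OF that] \<epsilon>(2) by (intro disjoint_ballI) simp
  obtain \<eta> where \<eta>: "\<eta> > 0" "\<And>z. dist (poly p z) y < \<eta> \<Longrightarrow> \<exists>v. poly p v = y \<and> dist z v < \<epsilon>"
    using poly_near_value_imp_near_preimage[OF deg \<epsilon>(1)] by blast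
  have opn: "open (poly p ` B)" if "v \<in> R" "B \<subseteq> ball v \<epsilon>" "open B" for v B
    by (rule invariance_of_domain) (use that inj in \<open>auto intro!: continuous_intros intro: inj_on_subset\<close>)
  \<comment> \<open>The disc images make every sheet map onto \<open>T\<close>; the factor
    \<open>ball y \<eta>\<close> forces every point over \<open>T\<close> into one of the
    discs.\<close>
  define T where "T = S \<inter> ball y \<eta> \<inter> (\<Inter>v\<in>R. poly p ` ball v \<epsilon>)"
  have "open T"
    unfolding T_def using \<open>open S\<close> opn finR by (auto intro!: open_INT)
  have "y \<in> poly p ` ball v \<epsilon>" if "v \<in> R" for v
    using that \<epsilon>(1) by (intro image_eqI[of _ _ v]) (auto simp: R_def)
  then have "y \<in> T"
    using \<open>y \<in> S\<close> \<eta>(1) by (simp add: T_def)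
  define \<V> where "\<V> = (\<lambda>v. ball v \<epsilon> \<inter> poly p -` T) ` R"
  have opV: "open u" if "u \<in> \<V>" for u
    using that \<open>open T\<close> by (auto simp: \<V>_def intro!: open_Int open_vimage continuous_intros)
  have "\<Union>\<V> = poly p -` S \<inter> poly p -` T"
  proof -
    have "\<exists>v\<in>R. z \<in> ball v \<epsilon>" if "poly p z \<in> T" for z
      using \<eta>(2)[of z] that by (auto simp: T_def R_def dist_commute)
    then show ?thesis by (auto simp: \<V>_def T_def)
  qed
  moreover have "pairwise disjnt \<V>"
    unfolding \<V>_def
  proof (rule pairwise_imageI)
    show "disjnt (ball v \<epsilon> \<inter> poly p -` T) (ball w \<epsilon> \<inter> poly p -` T)" if "v \<in> R" "w \<in> R" "v \<noteq> w" for v w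
      using disj[OF that] unfolding disjnt_def by blast
  qed
  moreover have "\<exists>q. homeomorphism u T (poly p) q" if u: "u \<in> \<V>" for u
  proof -
    obtain v where v: "v \<in> R" "u = ball v \<epsilon> \<inter> poly p -` T" using u by (auto simp: \<V>_def)
    have "T \<subseteq> poly p ` ball v \<epsilon>" using v(1) by (auto simp: T_def)
    then have "poly p ` u = T" unfolding v(2) by blast
    moreover have "inj_on (poly p) u" using inj[OF v(1)] v(2) by (auto intro: inj_on_subset)
    moreover obtain q where "homeomorphism u (poly p ` u) (poly p) q"
      by (rule invariance_of_domain_homeomorphism[OF opV[OF u] _ _ \<open>inj_on (poly p) u\<close>])
        (auto intro: continuous_intros)
    ultimately show ?thesis by blast
  qed
  moreover have "openin (top_of_set S) T" "\<And>u. u \<in> \<V> \<Longrightarrow> openin (top_of_set (poly p -` S)) u"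
    using \<open>open T\<close> opV by (auto simp: T_def \<V>_def intro!: open_subset)
  ultimately show "\<exists>T. y \<in> T \<and> openin (top_of_set S) T \<and>
      (\<exists>v. \<Union> v = poly p -` S \<inter> poly p -` T \<and> (\<forall>u\<in>v. openin (top_of_set (poly p -` S)) u) \<and>
           pairwise disjnt v \<and> (\<forall>u\<in>v. \<exists>q. homeomorphism u T (poly p) q))"
    using \<open>y \<in> T\<close> by (intro exI[of _ T] exI[of _ \<V>] conjI ballI)
qed

text \<open>The preimage of the \<eta>-ball is covered by \<epsilon>-balls around the fibre, and
  separation makes the ball of v disjoint from the others, so a connected set cannot leave it. For
  given p, the number \<eta> depends on \<epsilon> and w alone; v and the set are chosen
  afterwards.\<close>

lemma poly_connected_near_preimage:
  fixes p :: "complex poly"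
  assumes deg: "degree p > 0" and "\<epsilon> > 0"
  obtains \<eta> where "\<eta> > 0"
    "\<And>A z v. connected A \<Longrightarrow> poly p ` A \<subseteq> ball w \<eta> \<Longrightarrow> z \<in> A \<Longrightarrow> poly p v = w \<Longrightarrow>
       (\<And>v'. poly p v' = w \<Longrightarrow> v' \<noteq> v \<Longrightarrow> 2 * \<epsilon> \<le> dist v v') \<Longrightarrow> z \<in> ball v \<epsilon> \<Longrightarrow> A \<subseteq> ball v \<epsilon>"
proof -
  obtain \<eta> where \<eta>: "\<eta> > 0" "\<And>z. dist (poly p z) w < \<eta> \<Longrightarrow> \<exists>v. poly p v = w \<and> dist z v < \<epsilon>"
    using poly_near_value_imp_near_preimage[OF deg \<open>\<epsilon> > 0\<close>] by blast
  show ?thesis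
  proof (rule that[OF \<eta>(1)])
    fix A z v
    assume *: "connected A" "poly p ` A \<subseteq> ball w \<eta>" "z \<in> A" "poly p v = w"
      "\<And>v'. poly p v' = w \<Longrightarrow> v' \<noteq> v \<Longrightarrow> 2 * \<epsilon> \<le> dist v v'" "z \<in> ball v \<epsilon>"
    define B where "B = \<Union> ((\<lambda>v'. ball v' \<epsilon>) ` {v'. poly p v' = w \<and> v' \<noteq> v})"
    have "A \<subseteq> ball v \<epsilon> \<union> B"
    proof
      fix a assume "a \<in> A"
      then have "poly p a \<in> ball w \<eta>" using *(2) by blast
      then show "a \<in> ball v \<epsilon> \<union> B"
        using \<eta>(2)[of a] by (auto simp: B_def dist_commute)
    qed
    moreover have "ball v \<epsilon> \<inter> B = {}"
    proof -
      have "ball v \<epsilon> \<inter> ball v' \<epsilon> = {}" if "poly p v' = w" "v' \<noteq> v" for v'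
        using *(5)[OF that] by (intro disjoint_ballI) auto
      then show ?thesis by (auto simp: B_def)
    qed
    moreover have "open B" by (auto simp: B_def)
    ultimately have "ball v \<epsilon> \<inter> A = {} \<or> B \<inter> A = {}"
      using connectedD[OF *(1), of "ball v \<epsilon>" B] by blast
    then show "A \<subseteq> ball v \<epsilon>"
      using *(3,6) \<open>A \<subseteq> ball v \<epsilon> \<union> B\<close> by blast
  qed
qed

text \<open>At a critical value the covering property gives no limit. Instead, near the end a the
  lift is trapped in an \<epsilon>-ball around some fibre point for each small \<epsilon>, and
  separation of the fibre makes that point the same for all \<epsilon>. Convexity of
  \<open>T\<close> keeps its part near a connected.\<close>

lemma poly_lift_tendsto:
  fixes p :: "complex poly" and g :: "real \<Rightarrow> complex"
  assumes deg: "degree p > 0" and T: "convex T" "a \<in> closure T" "a \<notin> T"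
    and contg: "continuous_on T g" and lim: "((\<lambda>t. poly p (g t)) \<longlongrightarrow> w) (at a within T)"
  obtains v where "poly p v = w" "(g \<longlongrightarrow> v) (at a within T)"
proof -
  obtain \<delta> where \<delta>: "\<delta> > 0" "\<And>x y. poly p x = w \<Longrightarrow> poly p y = w \<Longrightarrow> x \<noteq> y \<Longrightarrow> \<delta> \<le> dist x y"
    using poly_fibre_separated[OF deg] by blast
  have lp: "a islimpt T"
    using T by (simp add: closure_def)
  have ev: "\<exists>v d. d > 0 \<and> poly p v = w \<and> g ` (T \<inter> ball a d) \<subseteq> ball v \<epsilon>" if \<epsilon>: "\<epsilon> > 0" "\<epsilon> \<le> \<delta> / 2" for \<epsilon>
  proof -
    obtain \<eta> where \<eta>: "\<eta> > 0"
      "\<And>A z v. connected A \<Longrightarrow> poly p ` A \<subseteq> ball w \<eta> \<Longrightarrow> z \<in> A \<Longrightarrow> poly p v = w \<Longrightarrow>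
       (\<And>v'. poly p v' = w \<Longrightarrow> v' \<noteq> v \<Longrightarrow> 2 * \<epsilon> \<le> dist v v') \<Longrightarrow> z \<in> ball v \<epsilon> \<Longrightarrow> A \<subseteq> ball v \<epsilon>"
      using poly_connected_near_preimage[OF deg \<epsilon>(1)] by metis
    obtain \<eta>' where \<eta>': "\<eta>' > 0" "\<And>z. dist (poly p z) w < \<eta>' \<Longrightarrow> \<exists>v. poly p v = w \<and> dist z v < \<epsilon>"
      using poly_near_value_imp_near_preimage[OF deg \<epsilon>(1)] by blast
    have "\<forall>\<^sub>F t in at a within T. dist (poly p (g t)) w < min \<eta> \<eta>'"
      using lim \<eta>(1) \<eta>'(1) by (intro tendstoD) auto
    then obtain d where d: "d > 0" "\<And>t. t \<in> T \<Longrightarrow> dist t a < d \<Longrightarrow> dist (poly p (g t)) w < min \<eta> \<eta>'"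
      using T(3) unfolding eventually_at by metis
    obtain t0 where t0: "t0 \<in> T" "dist t0 a < d"
      using lp d(1) by (metis islimpt_approachable)
    obtain v where v: "poly p v = w" "dist (g t0) v < \<epsilon>"
      using \<eta>'(2) d(2)[OF t0] by auto
    have "g ` (T \<inter> ball a d) \<subseteq> ball v \<epsilon>"
    proof (rule \<eta>(2))
      have "connected (T \<inter> ball a d)" using T(1) by (intro convex_connected convex_Int) auto
      then show "connected (g ` (T \<inter> ball a d))"
        using contg by (intro connected_continuous_image) (auto intro: continuous_on_subset)
      show "poly p ` g ` (T \<inter> ball a d) \<subseteq> ball w \<eta>"
        using d(2) by (force simp: dist_commute)
      show "g t0 \<in> g ` (T \<inter> ball a d)" using t0 by (auto simp: dist_commute)
      show "2 * \<epsilon> \<le> dist v v'" if "poly p v' = w" "v' \<noteq> v" for v'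
        using \<delta>(2)[of v v'] that v \<epsilon>(2) by auto
    qed (use v in \<open>auto simp: dist_commute\<close>)
    then show ?thesis using d(1) v(1) by blast
  qed
  obtain v d where v: "d > 0" "poly p v = w" "g ` (T \<inter> ball a d) \<subseteq> ball v (\<delta> / 2)"
    using ev[of "\<delta> / 2"] \<delta>(1) by auto
  show ?thesis
  proof (rule that[OF v(2)])
    show "(g \<longlongrightarrow> v) (at a within T)"
    proof (rule tendstoI)
      fix e :: real assume "e > 0"
      define \<epsilon> where "\<epsilon> = min e (\<delta> / 2)"
      have \<epsilon>: "\<epsilon> > 0" "\<epsilon> \<le> \<delta> / 2" "\<epsilon> \<le> e" using \<open>e > 0\<close> \<delta>(1) by (auto simp: \<epsilon>_def)
      obtain v' d' where v': "d' > 0" "poly p v' = w" "g ` (T \<inter> ball a d') \<subseteq> ball v' \<epsilon>"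
        using ev[OF \<epsilon>(1,2)] by blast
      obtain t where t: "t \<in> T" "dist t a < min d d'"
        using lp v(1) v'(1) by (metis islimpt_approachable min_less_iff_conj)
      have "t \<in> T \<inter> ball a d" "t \<in> T \<inter> ball a d'" using t by (auto simp: dist_commute)
      then have "g t \<in> ball v (\<delta> / 2)" "g t \<in> ball v' \<epsilon>"
        using v(3) v'(3) by blast+
      then have "dist v v' < \<delta>"
        using \<epsilon>(2) dist_triangle[of v v' "g t"] by (simp add: dist_commute)
      then have "v' = v" using \<delta>(2) v(2) v'(2) by (metis not_less)
      have "dist (g u) v < e" if "u \<in> T" "dist u a < d'" for u
      proof -
        have "u \<in> T \<inter> ball a d'" using that by (auto simp: dist_commute)
        then have "g u \<in> ball v' \<epsilon>" using v'(3) by blast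
        then show ?thesis using \<epsilon>(3) \<open>v' = v\<close> by (simp add: dist_commute)
      qed
      then show "\<forall>\<^sub>F t in at a within T. dist (g t) v < e"
        unfolding eventually_at using v'(1) by blast
    qed
  qed
qed

section \<open>External rays\<close>

text \<open>Writing f = a + z q(z) with q nonconstant, q has norm at least 3 far out, and one of the
  three multiples of the norm of z absorbs the constant a.\<close>

lemma poly_doubles_near_infinity:
  fixes f :: "complex poly"
  assumes "degree f \<ge> 2"
  obtains R where "R > 0" "\<And>z. norm z \<ge> R \<Longrightarrow> 2 * norm z \<le> norm (poly f z)"
proof -
  obtain a q where f: "f = pCons a q" by (cases f)
  obtain b r where q: "q = pCons b r" by (cases q)
  have "r \<noteq> 0" using assms by (auto simp: f q split: if_splits)
  obtain s where s: "\<And>z::complex. s \<le> norm z \<Longrightarrow> 3 \<le> norm (poly q z)"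
    using poly_infinity[OF \<open>r \<noteq> 0\<close>, of 3 b] unfolding q by blast
  show ?thesis
  proof (rule that[of "max 1 (max s (norm a))"])
    fix z :: complex assume z: "max 1 (max s (norm a)) \<le> norm z"
    have "norm z * 3 \<le> norm z * norm (poly q z)"
      using s z by (intro mult_left_mono) auto
    also have "\<dots> = norm (poly f z - a)" by (simp add: f norm_mult)
    also have "\<dots> \<le> norm (poly f z) + norm a" by (rule norm_triangle_ineq4)
    finally show "2 * norm z \<le> norm (poly f z)" using z by simp
  qed auto
qed

text \<open>The open sets \<open>Q n\<close> of points outside radius R at time n increase with n,
  because norms at least double there, and they cover \<open>K\<close>. Compactness gives one common
  time \<open>M\<close>, and further doubling passes any bound B.\<close>

lemma escape_uniformly_on_compact:
  fixes f :: "complex poly"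
  assumes deg: "degree f \<ge> 2" and K: "compact K" "K \<inter> filled_julia f = {}"
  obtains N where "\<And>n z. n \<ge> N \<Longrightarrow> z \<in> K \<Longrightarrow> B < norm ((poly f ^^ n) z)"
proof -
  obtain R where R: "R > 0" "\<And>z. norm z \<ge> R \<Longrightarrow> 2 * norm z \<le> norm (poly f z)"
    using poly_doubles_near_infinity[OF deg] by blast
  have grow: "R * 2 ^ k < norm ((poly f ^^ (n + k)) z)" if "R < norm ((poly f ^^ n) z)" for n k z
  proof (induction k)
    case (Suc k)
    have "R * 1 \<le> R * 2 ^ k" using R(1) by (intro mult_left_mono) auto
    then have "2 * norm ((poly f ^^ (n + k)) z) \<le> norm ((poly f ^^ (n + Suc k)) z)"
      using R(2)[of "(poly f ^^ (n + k)) z"] Suc by simp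
    then show ?case using Suc by simp
  qed (use that in simp)
  define Q where "Q n = {z. R < norm ((poly f ^^ n) z)}" for n
  have cont: "continuous_on UNIV (poly f ^^ n)" for n
    by (induction n) (auto intro!: continuous_on_compose2[of UNIV "poly f"] continuous_intros simp: comp_def id_def)
  have opn: "open (Q n)" for n
    unfolding Q_def by (intro open_Collect_less continuous_intros cont)
  have mono: "Q m \<subseteq> Q n" if "m \<le> n" for m n
  proof
    fix z assume "z \<in> Q m"
    have "R * 1 \<le> R * 2 ^ (n - m)" using R(1) by (intro mult_left_mono) auto
    also have "\<dots> < norm ((poly f ^^ (m + (n - m))) z)"
      using grow[of m z "n - m"] \<open>z \<in> Q m\<close> by (simp only: Q_def mem_Collect_eq)
    finally show "z \<in> Q n" using that by (simp add: Q_def)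
  qed
  have "K \<subseteq> (\<Union>n. Q n)"
  proof
    fix z assume "z \<in> K"
    then have "\<not> bounded (range (\<lambda>n. (poly f ^^ n) z))"
      using K(2) by (auto simp: filled_julia_def)
    then show "z \<in> (\<Union>n. Q n)"
      by (auto simp: bounded_iff Q_def not_le)
  qed
  then obtain D where D: "finite D" "K \<subseteq> (\<Union>n\<in>D. Q n)"
    using compactE_image[OF K(1), of UNIV Q] opn by auto
  define M where "M = Max (insert 0 D)"
  have KM: "K \<subseteq> Q M"
  proof -
    have "n \<le> M" if "n \<in> D" for n using that D(1) by (simp add: M_def)
    then have "(\<Union>n\<in>D. Q n) \<subseteq> Q M" using mono by blast
    then show ?thesis using D(2) by blast
  qed
  obtain k0 where k0: "B < R * 2 ^ k0"
    using real_arch_pow[of 2 "B / R"] R(1) by (auto simp: field_simps)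
  show ?thesis
  proof (rule that[of "M + k0"])
    fix n z assume "n \<ge> M + k0" "z \<in> K"
    then obtain k where k: "n = M + k" "k \<ge> k0" by (metis add.assoc le_Suc_ex le_add1)
    have "R * 2 ^ k0 \<le> R * 2 ^ k" using R(1) k(2) by (intro mult_left_mono power_increasing) auto
    then show "B < norm ((poly f ^^ n) z)"
      using k0 grow[of M z k] KM \<open>z \<in> K\<close> by (auto simp: Q_def k(1))
  qed
qed

section \<open>The Boettcher parametrization near infinity\<close>

lemma boettcher_param_iterate:
  assumes "boettcher_param f \<psi>" "degree f > 0" "1 < norm w"
  shows "(poly f ^^ n) (\<psi> w) = \<psi> (w ^ (degree f ^ n))"
proof (induction n)
  case (Suc n)
  have "1 < norm (w ^ (degree f ^ n))"
    using assms by (simp add: norm_power)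
  then show ?case
    using assms(1) Suc by (simp add: boettcher_param_def mult.commute flip: power_mult)
qed simp

text \<open>That \<psi> tends to infinity is not stated in \<open>boettcher_param\<close> and comes
  from the dynamics. The closed annulus \<open>A\<close> between the radii 2 and 2^d contains a
  fundamental domain for w to w^d. Its image escapes uniformly, and a large w is a d^n-th power of a
  point of \<open>A\<close> with n large, so that \<psi> w is an n-th iterate of a point of that
  image.\<close>

lemma boettcher_param_at_infinity:
  assumes \<psi>: "boettcher_param f \<psi>" and deg: "degree f \<ge> 2"
  obtains R where "R \<ge> 1" "\<And>w. R < norm w \<Longrightarrow> B < norm (\<psi> w)"
proof -
  define d where "d = degree f"
  have d: "d \<ge> 2" using deg by (simp add: d_def)
  define A where "A = cball 0 (2 ^ d) - ball (0::complex) 2"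
  have A: "A \<subseteq> {w. 1 < norm w}" by (auto simp: A_def)
  have "compact A" unfolding A_def by (intro compact_diff) auto
  have "continuous_on A \<psi>"
    using \<psi> A continuous_on_subset[OF holomorphic_on_imp_continuous_on] by (auto simp: boettcher_param_def)
  then have cpt: "compact (\<psi> ` A)" using \<open>compact A\<close> by (rule compact_continuous_image)
  have "\<psi> ` {w. 1 < norm w} = - filled_julia f"
    using \<psi> by (auto simp: boettcher_param_def bij_betw_def)
  then have "\<psi> ` A \<inter> filled_julia f = {}"
    using A by blast
  then obtain N where N: "\<And>n z. n \<ge> N \<Longrightarrow> z \<in> \<psi> ` A \<Longrightarrow> B < norm ((poly f ^^ n) z)"
    using escape_uniformly_on_compact[OF deg cpt] by metis
  show ?thesis
  proof (rule that[of "2 ^ (d ^ N)"])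
    fix w :: complex assume w: "2 ^ (d ^ N) < norm w"
    define P where "P m \<longleftrightarrow> norm w < 2 ^ (d ^ m)" for m
    obtain k where k: "norm w < 2 ^ k" using real_arch_pow[of 2 "norm w"] by auto
    have "k \<le> d ^ k" using d less_exp[of k] power_mono[of 2 d k] by linarith
    then have "(2::real) ^ k \<le> 2 ^ (d ^ k)" by (intro power_increasing) auto
    then have "P k" using k unfolding P_def by linarith
    \<comment> \<open>With n = m - 1, minimality gives 2^(d^n) \<le> |w| < 2^(d^m), so every d^n-th
      root of w lies in \<open>A\<close>; the chosen radius forces n \<ge> N.\<close>
    define m where "m = (LEAST m. P m)"
    have "P m" unfolding m_def using \<open>P k\<close> by (rule LeastI)
    have "N < m"
    proof (rule ccontr)
      assume "\<not> N < m"
      then have "d ^ m \<le> d ^ N" using d by (intro power_increasing) auto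
      then have "(2::real) ^ (d ^ m) \<le> 2 ^ (d ^ N)" by (rule power_increasing) auto
      then show False using \<open>P m\<close> w unfolding P_def by linarith
    qed
    then obtain n where n: "m = Suc n" "n \<ge> N" by (cases m) auto
    have "\<not> P n" using not_less_Least[of n P] n by (simp add: m_def)
    obtain v where v: "v ^ (d ^ n) = w"
    proof (rule that)
      have "w \<noteq> 0" using w by auto
      then show "exp (Ln w / of_nat (d ^ n)) ^ (d ^ n) = w"
        using d by (simp flip: exp_of_nat_mult)
    qed
    have "2 \<le> norm v"
    proof (rule ccontr)
      assume "\<not> 2 \<le> norm v"
      then have "norm v ^ (d ^ n) < 2 ^ (d ^ n)" using d by (intro power_strict_mono) auto
      then show False using \<open>\<not> P n\<close> v by (simp add: P_def flip: norm_power)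
    qed
    moreover have "norm v \<le> 2 ^ d"
    proof (rule ccontr)
      assume "\<not> norm v \<le> 2 ^ d"
      then have "(2 ^ d) ^ (d ^ n) \<le> norm v ^ (d ^ n)" by (intro power_mono) auto
      then have "2 ^ (d ^ m) \<le> norm w" using v by (simp add: n flip: power_mult norm_power)
      then show False using \<open>P m\<close> by (simp add: P_def)
    qed
    ultimately have "v \<in> A" by (auto simp: A_def)
    then have "B < norm ((poly f ^^ n) (\<psi> v))" using N n(2) by blast
    also have "(poly f ^^ n) (\<psi> v) = \<psi> w"
      using boettcher_param_iterate[OF \<psi>, of v n] deg \<open>v \<in> A\<close> A v by (auto simp: d_def)
    finally show "B < norm (\<psi> w)" .
  qed auto
qed

text \<open>The end of the ray at infinity becomes the end \<open>0\<close> of the arc, so that theorems on complements of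
  arcs apply to rays.\<close>

lemma closed_external_ray_inverted_arc:
  assumes ray: "closed_external_ray f z \<gamma>" and deg: "degree f \<ge> 2" and z: "z \<in> filled_julia f"
    and a: "a \<notin> \<gamma>"
  obtains q where "arc q" "pathstart q = 0" "pathfinish q = inverse (z - a)"
    "path_image q = insert 0 ((\<lambda>x. inverse (x - a)) ` \<gamma>)"
proof -
  obtain \<psi> \<theta> where \<psi>: "boettcher_param f \<psi>"
    and lim: "((\<lambda>r. \<psi> (of_real r * cis \<theta>)) \<longlongrightarrow> z) (at_right 1)"
    and \<gamma>: "\<gamma> = insert z ((\<lambda>r. \<psi> (of_real r * cis \<theta>)) ` {1<..})"
    using ray by (auto simp: closed_external_ray_def)
  have bij: "inj_on \<psi> {w. 1 < norm w}" "\<psi> ` {w. 1 < norm w} = - filled_julia f"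
    using \<psi> by (auto simp: boettcher_param_def bij_betw_def)
  have cont\<psi>: "continuous_on {w. 1 < norm w} \<psi>"
    using \<psi> by (auto simp: boettcher_param_def intro: holomorphic_on_imp_continuous_on)
  define \<rho> where "\<rho> u = \<psi> (of_real (inverse u) * cis \<theta>)" for u :: real
  \<comment> \<open>The parameter is the inverse radius: 0 stands for infinity, which the inversion
    about a sends to 0, and 1 stands for the landing point.\<close>
  define q where "q u = (if u = 0 then 0 else if u = 1 then inverse (z - a) else inverse (\<rho> u - a))" for u :: real
  have big: "1 < norm (of_real (inverse u) * cis \<theta>)" if "0 < u" "u < 1" for u :: real
    using that one_less_inverse[of u] by (simp add: norm_mult norm_inverse)
  have im: "(\<lambda>r. \<psi> (of_real r * cis \<theta>)) ` {1<..} = \<rho> ` {0<..<1}"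
  proof -
    have "{1::real<..} = inverse ` {0<..<1}"
    proof (intro equalityI subsetI)
      fix x :: real assume "x \<in> {1<..}"
      then show "x \<in> inverse ` {0<..<1}"
        by (intro image_eqI[of _ _ "inverse x"]) (auto simp: inverse_less_1_iff)
    qed (auto simp: one_less_inverse)
    then show ?thesis by (simp add: \<rho>_def image_image)
  qed
  have notK: "\<rho> u \<notin> filled_julia f" if "u \<in> {0<..<1}" for u
    using bij(2) big[of u] that by (auto simp: \<rho>_def)
  have na: "\<rho> u \<noteq> a" if "u \<in> {0<..<1}" for u
    using a that im by (auto simp: \<gamma>)
  have "z \<noteq> a" using a \<gamma> by auto
  have cont\<rho>: "continuous_on {0<..<1} \<rho>"
    unfolding \<rho>_def
    by (rule continuous_on_compose2[OF cont\<psi>]) (use big in \<open>auto intro!: continuous_intros\<close>)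
  have "(q \<longlongrightarrow> 0) (at 0 within {0..1})"
  proof (rule tendstoI)
    fix e :: real assume "e > 0"
    obtain R where R: "R \<ge> 1" "\<And>w. R < norm w \<Longrightarrow> norm a + inverse e < norm (\<psi> w)"
      using boettcher_param_at_infinity[OF \<psi> deg] by blast
    have "dist (q u) 0 < e" if "u \<in> {0..1}" "u \<noteq> 0" "dist u 0 < inverse (R + 1)" for u
    proof -
      have "inverse (R + 1) < 1" using R(1) by (simp add: inverse_less_1_iff)
      then have u: "0 < u" "u < 1" "u < inverse (R + 1)" using that by auto
      have "R < inverse u" using u R(1) inverse_less_iff_less[of "inverse u" "R+1"]
        by (smt (verit) inverse_inverse_eq inverse_less_imp_less)
      then have "norm a + inverse e < norm (\<rho> u)"
        unfolding \<rho>_def using u by (intro R(2)) (simp add: norm_mult norm_inverse)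
      also have "\<dots> \<le> norm (\<rho> u - a) + norm a" by (metis add.commute norm_triangle_sub)
      finally have *: "inverse e < norm (\<rho> u - a)" by simp
      have "inverse (norm (\<rho> u - a)) < inverse (inverse e)"
        using * \<open>e > 0\<close> by (intro less_imp_inverse_less) auto
      then show ?thesis using u by (simp add: q_def norm_inverse)
    qed
    moreover have "inverse (R + 1) > 0" using R(1) by simp
    ultimately show "\<forall>\<^sub>F u in at 0 within {0..1}. dist (q u) 0 < e"
      unfolding eventually_at by blast
  qed
  moreover have "(q \<longlongrightarrow> inverse (z - a)) (at 1 within {0..1})"
  proof -
    have "(inverse \<longlongrightarrow> (1::real)) (at_left 1)"
      by (auto intro!: tendsto_eq_intros)
    moreover have "\<forall>\<^sub>F u in at_left (1::real). inverse u \<in> {1<..} \<and> inverse u \<noteq> 1"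
      using eventually_at_left_real[OF zero_less_one[where 'a = real]] by eventually_elim (auto simp: one_less_inverse)
    ultimately have "filterlim inverse (at_right 1) (at_left (1::real))"
      by (auto simp: filterlim_at)
    from filterlim_compose[OF lim this] have "(\<rho> \<longlongrightarrow> z) (at_left 1)"
      by (simp add: \<rho>_def[abs_def])
    then have "((\<lambda>u. inverse (\<rho> u - a)) \<longlongrightarrow> inverse (z - a)) (at_left 1)"
      using \<open>z \<noteq> a\<close> by (auto intro!: tendsto_intros)
    moreover have "\<forall>\<^sub>F u in at_left (1::real). inverse (\<rho> u - a) = q u"
      using eventually_at_left_real[OF zero_less_one[where 'a = real]] by eventually_elim (auto simp: q_def)
    ultimately have "(q \<longlongrightarrow> inverse (z - a)) (at_left 1)"
      by (rule Lim_transform_eventually)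
    moreover have "at (1::real) within {0..1} = at_left 1"
      by (simp add: at_within_Icc_at_left)
    ultimately show ?thesis by simp
  qed
  moreover have "(q \<longlongrightarrow> q u) (at u within {0..1})" if u: "u \<in> {0<..<1}" for u
  proof -
    have "continuous_on {0<..<1} (\<lambda>u. inverse (\<rho> u - a))"
      using na by (intro continuous_intros cont\<rho>) auto
    then have "continuous_on {0<..<1} q"
      by (rule continuous_on_eq) (auto simp: q_def)
    then have "(q \<longlongrightarrow> q u) (at u)"
      using u by (simp add: continuous_on_eq_continuous_at isCont_def)
    then show ?thesis by (rule tendsto_within_subset) simp
  qed
  ultimately have "continuous_on {0..1} q"
    unfolding continuous_on_def
  proof (intro ballI)
    fix u :: real assume "u \<in> {0..1}"
    then have "u = 0 \<or> u = 1 \<or> u \<in> {0<..<1}" by auto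
    then show "(q \<longlongrightarrow> q u) (at u within {0..1})"
      using \<open>(q \<longlongrightarrow> 0) (at 0 within {0..1})\<close> \<open>(q \<longlongrightarrow> inverse (z - a)) (at 1 within {0..1})\<close>
        \<open>\<And>u. u \<in> {0<..<1} \<Longrightarrow> (q \<longlongrightarrow> q u) (at u within {0..1})\<close>
      by (auto simp: q_def)
  qed
  moreover have "inj_on q {0..1}"
  proof -
    have "inj_on \<rho> {0<..<1}"
    proof (rule inj_onI)
      fix u v :: real assume uv: "u \<in> {0<..<1}" "v \<in> {0<..<1}" "\<rho> u = \<rho> v"
      have "of_real (inverse u) * cis \<theta> = of_real (inverse v) * cis \<theta>"
        using inj_onD[OF bij(1), of "of_real (inverse u) * cis \<theta>" "of_real (inverse v) * cis \<theta>"]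
          uv big[of u] big[of v] by (auto simp: \<rho>_def)
      then show "u = v" by simp
    qed
    \<comment> \<open>Ray points escape while the landing point has a bounded orbit, so the end of
      the arc is not hit a second time.\<close>
    moreover have "\<rho> u \<noteq> z" if "u \<in> {0<..<1}" for u using notK[OF that] z by auto
    ultimately show ?thesis
      unfolding inj_on_def
    proof (intro ballI impI)
      fix u v :: real
      assume uv: "u \<in> {0..1}" "v \<in> {0..1}" "q u = q v"
        and inj: "\<forall>x\<in>{0<..<1}. \<forall>y\<in>{0<..<1}. \<rho> x = \<rho> y \<longrightarrow> x = y"
        and nz: "\<And>u. u \<in> {0<..<1} \<Longrightarrow> \<rho> u \<noteq> z"
      have "u = 0 \<or> u = 1 \<or> u \<in> {0<..<1}" "v = 0 \<or> v = 1 \<or> v \<in> {0<..<1}"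
        using uv by auto
      then show "u = v"
        using uv(3) inj nz na \<open>z \<noteq> a\<close>
        by (elim disjE) (fastforce simp: q_def)+
    qed
  qed
  ultimately have "arc q" by (simp add: arc_def path_def)
  have I: "{0..1} = insert 0 (insert 1 {0<..<1::real})" by auto
  have "q ` {0<..<1} = (\<lambda>x. inverse (x - a)) ` \<rho> ` {0<..<1}"
    unfolding image_image by (rule image_cong) (auto simp: q_def)
  then have "path_image q = insert 0 ((\<lambda>x. inverse (x - a)) ` \<gamma>)"
    unfolding path_image_def \<gamma> im I image_insert by (simp add: q_def insert_commute)
  with \<open>arc q\<close> show ?thesis
    by (intro that[of q]) (auto simp: pathstart_def pathfinish_def q_def)
qed

text \<open>Inverted about a point a off the ray, the ray lies in a compact arc. A bound B for that
  arc keeps the ray at distance at least 1/B from a.\<close>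

lemma closed_external_ray_closed:
  assumes "closed_external_ray f z \<gamma>" "degree f \<ge> 2" "z \<in> filled_julia f"
  shows "closed \<gamma>"
  unfolding closed_def open_dist
proof (intro ballI)
  fix a assume "a \<in> - \<gamma>"
  then obtain q where q: "arc q" "path_image q = insert 0 ((\<lambda>x. inverse (x - a)) ` \<gamma>)"
    using closed_external_ray_inverted_arc[OF assms] by (metis ComplD)
  obtain B where B: "B > 0" "\<And>w. w \<in> path_image q \<Longrightarrow> norm w \<le> B"
    using bounded_arc_image[OF q(1)] by (auto simp: bounded_pos)
  have "y \<in> - \<gamma>" if "dist y a < inverse B" for y
  proof
    assume "y \<in> \<gamma>"
    then have "y \<noteq> a" using \<open>a \<in> - \<gamma>\<close> by auto
    have "inverse (norm (y - a)) \<le> B" using B(2)[of "inverse (y - a)"] q(2) \<open>y \<in> \<gamma>\<close> by (auto simp: norm_inverse)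
    moreover have "B < inverse (norm (y - a))"
      using that \<open>y \<noteq> a\<close> B(1) by (simp add: dist_norm field_simps)
    ultimately show False by simp
  qed
  then show "\<exists>e>0. \<forall>y. dist y a < e \<longrightarrow> y \<in> - \<gamma>" using B(1) by (intro exI[of _ "inverse B"]) auto
qed

lemma closed_external_ray_inter_filled_julia:
  assumes "closed_external_ray f z \<gamma>" "z \<in> filled_julia f"
  shows "\<gamma> \<inter> filled_julia f = {z}"
proof -
  obtain \<psi> \<theta> where \<psi>: "boettcher_param f \<psi>"
    and \<gamma>: "\<gamma> = insert z ((\<lambda>r. \<psi> (of_real r * cis \<theta>)) ` {1<..})"
    using assms(1) by (auto simp: closed_external_ray_def)
  have "\<psi> ` {w. 1 < norm w} = - filled_julia f"
    using \<psi> by (auto simp: boettcher_param_def bij_betw_def)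
  moreover have "of_real r * cis \<theta> \<in> {w. 1 < norm w}" if "r > 1" for r
    using that by (simp add: norm_mult)
  ultimately have "\<psi> (of_real r * cis \<theta>) \<notin> filled_julia f" if "r > 1" for r
    using that by blast
  then show ?thesis using assms(2) \<gamma> by auto
qed

lemma closed_external_ray_connected:
  assumes "closed_external_ray f z \<gamma>"
  shows "connected \<gamma>"
proof -
  obtain \<psi> \<theta> where \<psi>: "boettcher_param f \<psi>"
    and lim: "((\<lambda>r. \<psi> (of_real r * cis \<theta>)) \<longlongrightarrow> z) (at_right 1)"
    and \<gamma>: "\<gamma> = insert z ((\<lambda>r. \<psi> (of_real r * cis \<theta>)) ` {1<..})"
    using assms by (auto simp: closed_external_ray_def)
  define S where "S = (\<lambda>r. \<psi> (of_real r * cis \<theta>)) ` {1<..}"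
  have "continuous_on {w. 1 < norm w} \<psi>"
    using \<psi> by (auto simp: boettcher_param_def intro: holomorphic_on_imp_continuous_on)
  then have "continuous_on {1<..} (\<lambda>r. \<psi> (of_real r * cis \<theta>))"
    by (rule continuous_on_compose2) (auto intro!: continuous_intros simp: norm_mult)
  then have "connected S"
    unfolding S_def by (intro connected_continuous_image) auto
  have "z \<in> closure S"
    using closed_closure[of S] _ _ lim
  proof (rule Lim_in_closed_set)
    show "\<forall>\<^sub>F r in at_right 1. \<psi> (of_real r * cis \<theta>) \<in> closure S"
      using eventually_at_right_less[of "1::real"]
      by eventually_elim (auto simp: S_def intro!: subsetD[OF closure_subset])
  qed simp
  then show ?thesis
    using connected_intermediate_closure[OF \<open>connected S\<close>, of \<gamma>] closure_subset[of S]
    by (auto simp: \<gamma> S_def)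
qed

lemma closed_external_ray_unbounded:
  assumes ray: "closed_external_ray f z \<gamma>" and deg: "degree f \<ge> 2"
  shows "\<not> bounded \<gamma>"
proof
  assume "bounded \<gamma>"
  obtain \<psi> \<theta> where \<psi>: "boettcher_param f \<psi>"
    and \<gamma>: "\<gamma> = insert z ((\<lambda>r. \<psi> (of_real r * cis \<theta>)) ` {1<..})"
    using ray by (auto simp: closed_external_ray_def)
  obtain B where B: "\<And>w. w \<in> \<gamma> \<Longrightarrow> norm w \<le> B"
    using \<open>bounded \<gamma>\<close> by (auto simp: bounded_iff)
  obtain R where R: "R \<ge> 1" "\<And>w. R < norm w \<Longrightarrow> B < norm (\<psi> w)"
    using boettcher_param_at_infinity[OF \<psi> deg] by blast
  have "B < norm (\<psi> (of_real (R + 1) * cis \<theta>))"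
    using R(1) by (intro R(2)) (simp add: norm_mult del: of_real_add)
  moreover have "\<psi> (of_real (R + 1) * cis \<theta>) \<in> \<gamma>"
    unfolding \<gamma> using R(1) by (intro insertI2 imageI) auto
  ultimately show False using B by fastforce
qed

section \<open>Complements of rays in the plane\<close>

lemma connected_complement_inverted_arc:
  fixes \<Gamma> :: "complex set"
  assumes q: "arc q" "0 \<in> path_image q" "path_image q = insert 0 ((\<lambda>x. inverse (x - a)) ` \<Gamma>)"
    and "a \<notin> \<Gamma>" and "closed \<Gamma>"
  shows "connected (- \<Gamma>)"
proof -
  have "connected (- path_image q)"
    using q(1) by (rule connected_arc_complement) simp
  then have "connected ((\<lambda>w. inverse w + a) ` (- path_image q))"
    using q(2) by (intro connected_continuous_image continuous_intros) auto
  also have "(\<lambda>w. inverse w + a) ` (- path_image q) = - \<Gamma> - {a}"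
  proof (intro equalityI subsetI)
    fix x assume "x \<in> (\<lambda>w. inverse w + a) ` (- path_image q)"
    then obtain w where w: "w \<notin> path_image q" "x = inverse w + a" by auto
    have "x \<notin> \<Gamma>"
    proof
      assume "x \<in> \<Gamma>"
      then have "inverse (x - a) \<in> path_image q" using q(3) by auto
      then show False using w by simp
    qed
    moreover have "w \<noteq> 0" using w q(2) by auto
    ultimately show "x \<in> - \<Gamma> - {a}" using w by auto
  next
    fix x assume x: "x \<in> - \<Gamma> - {a}"
    have "inverse (x - a) \<notin> path_image q"
      using x by (auto simp: q(3))
    then show "x \<in> (\<lambda>w. inverse w + a) ` (- path_image q)"
      by (intro image_eqI[of _ _ "inverse (x - a)"]) auto
  qed
  finally have con: "connected (- \<Gamma> - {a})" .
  \<comment> \<open>The inversion loses its centre a. As \<Gamma> is closed, a is a limit point of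
    the complement, and adding it back preserves connectedness.\<close>
  have "a \<in> closure (- \<Gamma> - {a})"
  proof -
    have "open (- \<Gamma>)" using \<open>closed \<Gamma>\<close> by auto
    then have "a islimpt (- \<Gamma>)" using \<open>a \<notin> \<Gamma>\<close> by (simp add: interior_limit_point interior_open)
    then show ?thesis by (simp add: islimpt_in_closure)
  qed
  then show ?thesis
    using connected_intermediate_closure[OF con, of "- \<Gamma>"] closure_subset[of "- \<Gamma> - {a}"] by auto
qed

text \<open>Rests on the planar criterion that a connected open set is simply connected when its
  complement has no bounded component. The last hypothesis is pointwise so that it serves one ray
  and a union of two alike.\<close>

lemma simply_connected_complement:
  fixes \<Gamma> :: "complex set"
  assumes "closed \<Gamma>" "connected (- \<Gamma>)"
    and unb: "\<And>x. x \<in> \<Gamma> \<Longrightarrow> \<exists>A\<subseteq>\<Gamma>. x \<in> A \<and> connected A \<and> \<not> bounded A"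
  shows "simply_connected (- \<Gamma>)"
proof -
  have "\<not> bounded C" if C: "C \<in> components \<Gamma>" for C
  proof -
    obtain x where x: "x \<in> \<Gamma>" "x \<in> C"
      using C in_components_nonempty in_components_subset by blast
    then obtain A where A: "A \<subseteq> \<Gamma>" "x \<in> A" "connected A" "\<not> bounded A" using unb by blast
    then have "A \<subseteq> C" using components_maximal[OF C] x by blast
    then show ?thesis using A(4) bounded_subset by blast
  qed
  then show ?thesis
    using assms(1,2) simply_connected_eq_unbounded_complement_components[of "- \<Gamma>"] by auto
qed

lemma simply_connected_complement_closed_external_ray:
  assumes ray: "closed_external_ray f z \<gamma>" and deg: "degree f \<ge> 2" and z: "z \<in> filled_julia f"
    and a: "a \<notin> \<gamma>"
  shows "simply_connected (- \<gamma>)"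
proof (rule simply_connected_complement)
  show cl: "closed \<gamma>" by (rule closed_external_ray_closed[OF ray deg z])
  obtain q where q: "arc q" "path_image q = insert 0 ((\<lambda>x. inverse (x - a)) ` \<gamma>)"
    using closed_external_ray_inverted_arc[OF ray deg z a] by metis
  show "connected (- \<gamma>)"
    by (rule connected_complement_inverted_arc[OF q(1) _ q(2) a cl]) (simp add: q(2))
  show "\<exists>A\<subseteq>\<gamma>. x \<in> A \<and> connected A \<and> \<not> bounded A" if "x \<in> \<gamma>" for x
    using closed_external_ray_connected[OF ray] closed_external_ray_unbounded[OF ray deg] that by blast
qed

lemma simply_connected_complement_closed_external_rays:
  assumes ray0: "closed_external_ray f z0 \<gamma>0" and ray1: "closed_external_ray f z1 \<gamma>1"
    and deg: "degree f \<ge> 2" and z: "z0 \<in> filled_julia f" "z1 \<in> filled_julia f"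
    and disj: "\<gamma>0 \<inter> \<gamma>1 = {}" and a: "a \<notin> \<gamma>0 \<union> \<gamma>1"
  shows "simply_connected (- (\<gamma>0 \<union> \<gamma>1))"
proof (rule simply_connected_complement)
  show cl: "closed (\<gamma>0 \<union> \<gamma>1)"
    using closed_external_ray_closed ray0 ray1 deg z by blast
  obtain q0 where q0: "arc q0" "pathstart q0 = 0" "path_image q0 = insert 0 ((\<lambda>x. inverse (x - a)) ` \<gamma>0)"
    using closed_external_ray_inverted_arc[OF ray0 deg z(1), of a] a by (metis UnI1)
  obtain q1 where q1: "arc q1" "pathstart q1 = 0" "path_image q1 = insert 0 ((\<lambda>x. inverse (x - a)) ` \<gamma>1)"
    using closed_external_ray_inverted_arc[OF ray1 deg z(2), of a] a by (metis UnI2)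
  have "inverse (x - a) \<noteq> inverse (y - a)" if "x \<in> \<gamma>0" "y \<in> \<gamma>1" for x y
    using that disj by auto
  then have "path_image q0 \<inter> path_image q1 \<subseteq> {0}"
    by (auto simp: q0(3) q1(3))
  \<comment> \<open>Both inverted rays start at 0, the image of infinity, and meet nowhere else, so
    the two rays together become one arc through infinity.\<close>
  then have "arc (reversepath q0 +++ q1)"
    using q0 q1 by (intro arc_join arc_reversepath) auto
  then show "connected (- (\<gamma>0 \<union> \<gamma>1))"
    by (rule connected_complement_inverted_arc[where a = a])
      (use q0 q1 a cl in \<open>auto simp: path_image_join\<close>)
  show "\<exists>A\<subseteq>\<gamma>0 \<union> \<gamma>1. x \<in> A \<and> connected A \<and> \<not> bounded A" if "x \<in> \<gamma>0 \<union> \<gamma>1" for x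
    using closed_external_ray_connected[OF ray0] closed_external_ray_unbounded[OF ray0 deg]
      closed_external_ray_connected[OF ray1] closed_external_ray_unbounded[OF ray1 deg] that
    by (metis Un_iff sup_ge1 sup_ge2)
qed

section \<open>Loops around a puncture\<close>

text \<open>Free homotopy is conjugacy, and the fundamental group of the punctured domain is abelian.\<close>

lemma homotopic_loops_imp_homotopic_paths_punctured:
  fixes p q :: "real \<Rightarrow> complex"
  assumes W: "open W" "simply_connected W" and "v \<in> W"
    and hom: "homotopic_loops (W - {v}) p q" and start: "pathstart p = pathstart q"
  shows "homotopic_paths (W - {v}) p q"
proof -
  \<comment> \<open>By the Riemann mapping theorem \<open>W\<close> may be replaced by the whole
    plane, where winding numbers classify loops around one point.\<close>
  have "W homeomorphic (UNIV :: complex set)"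
    using simply_connected_eq_homeomorphic_to_disc[OF W(1)] W(2) \<open>v \<in> W\<close> homeomorphic_ball01_UNIV
      homeomorphic_trans by blast
  then obtain h and k :: "complex \<Rightarrow> complex" where hk: "homeomorphism W UNIV h k"
    unfolding homeomorphic_def by blast
  have h: "continuous_on W h" "\<And>x. x \<in> W \<Longrightarrow> k (h x) = x" and k: "continuous_on UNIV k" "\<And>y. k y \<in> W" "\<And>y. h (k y) = y"
    using hk by (auto simp: homeomorphism_def)
  have pq: "path p" "path q" "path_image p \<subseteq> W - {v}" "path_image q \<subseteq> W - {v}"
    "pathfinish p = pathstart p" "pathfinish q = pathstart q"
    using homotopic_loops_imp_path[OF hom] homotopic_loops_imp_subset[OF hom] homotopic_loops_imp_loop[OF hom]
    by auto
  have "homotopic_loops (- {h v}) (h \<circ> p) (h \<circ> q)"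
  proof (rule homotopic_loops_continuous_image[OF hom])
    show "continuous_on (W - {v}) h" using h(1) by (rule continuous_on_subset) auto
    have "h x \<noteq> h v" if "x \<in> W - {v}" for x
      using h(2)[of x] h(2)[of v] that \<open>v \<in> W\<close> by auto
    then show "h \<in> W - {v} \<rightarrow> - {h v}" by blast
  qed
  \<comment> \<open>In the punctured plane, loops with a common base point are homotopic with fixed
    ends exactly when their winding numbers agree, and free homotopy preserves these.\<close>
  then have "homotopic_paths (- {h v}) (h \<circ> p) (h \<circ> q)"
    using winding_number_homotopic_loops[of "h v" "h \<circ> p" "h \<circ> q"] homotopic_loops_imp_path[of "- {h v}" "h \<circ> p" "h \<circ> q"]
      homotopic_loops_imp_subset[of "- {h v}" "h \<circ> p" "h \<circ> q"] start pq
    by (subst winding_number_homotopic_paths_eq[symmetric]) (auto simp: pathstart_compose pathfinish_compose)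
  then have *: "homotopic_paths (W - {v}) (k \<circ> (h \<circ> p)) (k \<circ> (h \<circ> q))"
    by (rule homotopic_paths_continuous_image) (use k in \<open>force intro: continuous_on_subset\<close>)+
  have "homotopic_paths (W - {v}) p (k \<circ> (h \<circ> p))"
    by (rule homotopic_paths_eq) (use pq h in \<open>auto simp: path_image_def subset_iff\<close>)
  moreover have "homotopic_paths (W - {v}) q (k \<circ> (h \<circ> q))"
    by (rule homotopic_paths_eq) (use pq h in \<open>auto simp: path_image_def subset_iff\<close>)
  ultimately show ?thesis
    using * by (meson homotopic_paths_trans homotopic_paths_sym)
qed

text \<open>Interpolating the logarithms of A and C rotates and rescales at once: the factor
  \<open>R s\<close> never vanishes, and its norm is at most the larger of the two given
  norms.\<close>

lemma homotopic_loops_circles: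
  assumes "A \<noteq> 0" "C \<noteq> 0" "norm A < r" "norm C < r"
  shows "homotopic_loops (ball v r - {v}) (\<lambda>u. v + A * exp (2 * of_real pi * \<i> * of_real u))
    (\<lambda>u. v + C * exp (2 * of_real pi * \<i> * of_real u))"
proof -
  define R where "R s = exp ((1 - of_real s) * Ln A + of_real s * Ln C)" for s :: real
  have nR: "norm (R s) < r" if "s \<in> {0..1}" for s
  proof -
    have "norm (R s) = exp ((1 - s) * ln (norm A) + s * ln (norm C))"
      using assms by (simp add: R_def)
    also have "(1 - s) * ln (norm A) + s * ln (norm C) \<le> (1 - s) * ln (max (norm A) (norm C)) + s * ln (max (norm A) (norm C))"
      using assms that by (intro add_mono mult_left_mono ln_mono) auto
    also have "\<dots> = ln (max (norm A) (norm C))" by (simp add: algebra_simps)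
    also have "exp \<dots> = max (norm A) (norm C)" using assms by (simp add: less_max_iff_disj)
    also have "\<dots> < r" using assms by simp
    finally show ?thesis by simp
  qed
  have R0: "R 0 = A" "R 1 = C" "R s \<noteq> 0" for s using assms by (auto simp: R_def)
  show ?thesis
    unfolding homotopic_loops
  proof (rule exI[of _ "\<lambda>x. v + R (fst x) * exp (2 * of_real pi * \<i> * of_real (snd x))"], intro conjI ballI)
    show "continuous_on ({0..1} \<times> {0..1}) (\<lambda>x. v + R (fst x) * exp (2 * of_real pi * \<i> * of_real (snd x)))"
      unfolding R_def by (intro continuous_intros)
    show "(\<lambda>x. v + R (fst x) * exp (2 * of_real pi * \<i> * of_real (snd x))) \<in> {0..1} \<times> {0..1} \<rightarrow> ball v r - {v}"
      using nR R0 by (auto simp: dist_norm norm_mult)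
  qed (auto simp: R0 pathfinish_def pathstart_def)
qed

text \<open>With relative error at most 1/2 the segment from c u to the circle point cannot meet v,
  and its distance to v stays below 3 \<delta> / 2; hence the ball of radius 2 \<delta>. The loop c
  thus inherits the single counterclockwise turn of the circle.\<close>

lemma homotopic_loops_circle_near:
  fixes c :: "real \<Rightarrow> complex"
  assumes c: "path c" "pathfinish c = pathstart c" "path_image c \<subseteq> ball v \<delta> - {v}"
    and near: "\<And>u. u \<in> {0..1} \<Longrightarrow> norm (A * exp (2 * of_real pi * \<i> * of_real u) - (c u - v)) \<le> norm (c u - v) / 2"
    and C: "C \<noteq> 0" "norm C < 2 * \<delta>"
  shows "homotopic_loops (ball v (2 * \<delta>) - {v}) c (\<lambda>u. v + C * exp (2 * of_real pi * \<i> * of_real u))"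
proof -
  let ?e = "\<lambda>u. exp (2 * of_real pi * \<i> * of_real u)"
  have cu: "norm (c u - v) < \<delta>" "c u \<noteq> v" if "u \<in> {0..1}" for u
    using c(3) that by (auto simp: path_image_def dist_norm norm_minus_commute image_subset_iff)
  have lin: "homotopic_loops (ball v (2 * \<delta>) - {v}) c (\<lambda>u. v + A * ?e u)"
  proof (rule homotopic_loops_linear)
    show "path (\<lambda>u. v + A * ?e u)" unfolding path_def by (intro continuous_intros)
    show "pathfinish (\<lambda>u. v + A * ?e u) = pathstart (\<lambda>u. v + A * ?e u)"
      by (simp add: pathfinish_def pathstart_def)
    fix u :: real and x assume u: "u \<in> {0..1}"
    show "closed_segment (c u) (v + A * ?e u) \<subseteq> ball v (2 * \<delta>) - {v}"
    proof
      fix z assume "z \<in> closed_segment (c u) (v + A * ?e u)"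
      then obtain s where s: "0 \<le> s" "s \<le> 1" "z = (1 - s) *\<^sub>R c u + s *\<^sub>R (v + A * ?e u)"
        by (auto simp: closed_segment_def)
      define d where "d = s *\<^sub>R (A * ?e u - (c u - v))"
      have z: "z - v = (c u - v) + d"
        by (simp add: s d_def algebra_simps)
      have "norm d \<le> 1 * (norm (c u - v) / 2)"
        unfolding d_def norm_scaleR using s near[OF u] by (intro mult_mono) auto
      moreover have "norm (c u - v) > 0" using cu[OF u] by simp
      moreover have "norm (z - v) \<le> norm (c u - v) + norm d" "norm (c u - v) - norm d \<le> norm (z - v)"
        unfolding z using norm_triangle_ineq norm_diff_ineq by blast+
      ultimately have "norm (z - v) > 0" "norm (z - v) < 2 * \<delta>"
        using cu(1)[OF u] by linarith+
      then show "z \<in> ball v (2 * \<delta>) - {v}"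
        by (auto simp: dist_norm norm_minus_commute)
    qed
  qed (use c in auto)
  have "norm (A * ?e 0) \<le> norm (A * ?e 0 - (c 0 - v)) + norm (c 0 - v)"
    using norm_triangle_ineq[of "A * ?e 0 - (c 0 - v)" "c 0 - v"] by simp
  then have A: "norm A < 2 * \<delta>" "A \<noteq> 0"
    using near[of 0] cu[of 0] zero_less_norm_iff[of "c 0 - v"] norm_minus_commute[of v "c 0"]
    by (auto simp del: zero_less_norm_iff)
  from lin homotopic_loops_circles[OF A(2) C(1) A(1) C(2)] show ?thesis
    by (rule homotopic_loops_trans)
qed

text \<open>Differentiability at v bounds the error of the linear part by half of its norm; dividing
  by the derivative yields the form in which a lifted circle is compared with a genuine one.\<close>

lemma poly_linear_approx_near:
  fixes p :: "complex poly"
  assumes "poly (pderiv p) v \<noteq> 0"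
  obtains \<delta> where "\<delta> > 0" "inj_on (poly p) (ball v \<delta>)"
    "\<And>z. z \<in> ball v \<delta> \<Longrightarrow> norm ((poly p z - poly p v) / poly (pderiv p) v - (z - v)) \<le> norm (z - v) / 2"
proof -
  define D where "D = poly (pderiv p) v"
  obtain r where r: "r > 0" "inj_on (poly p) (ball v r)"
    using has_complex_derivative_locally_injective[of "poly p" UNIV v] assms
    by (auto simp: holomorphic_intros DERIV_imp_deriv[OF poly_DERIV])
  have "(poly p has_derivative (*) D) (at v)"
    using poly_DERIV[of p v] by (simp add: has_field_derivative_def D_def)
  then obtain d where d: "d > 0"
    "\<And>z. norm (z - v) < d \<Longrightarrow> norm (poly p z - poly p v - D * (z - v)) \<le> norm D / 2 * norm (z - v)"
    unfolding has_derivative_at_alt using assms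
    by (metis D_def half_gt_zero zero_less_norm_iff)
  show ?thesis
  proof (rule that[of "min r d"])
    show "inj_on (poly p) (ball v (min r d))" using r(2) by (rule inj_on_subset) auto
    fix z assume "z \<in> ball v (min r d)"
    then have "norm (z - v) < d" by (auto simp: dist_norm norm_minus_commute)
    have "norm ((poly p z - poly p v) / D - (z - v)) = norm (poly p z - poly p v - D * (z - v)) / norm D"
      using assms by (simp add: D_def field_simps flip: norm_divide)
    also have "\<dots> \<le> norm D / 2 * norm (z - v) / norm D"
      by (intro divide_right_mono d(2)) (use \<open>norm (z - v) < d\<close> in auto)
    also have "\<dots> = norm (z - v) / 2" using assms by (simp add: D_def)
    finally show "norm ((poly p z - poly p v) / poly (pderiv p) v - (z - v)) \<le> norm (z - v) / 2"
      by (simp add: D_def)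
  qed (use r d in auto)
qed

text \<open>A lift of a small circle around p (g 0) that starts at g t is connected and begins close
  to g 0, so it cannot move on to another preimage. The path c is quantified after t because the
  lift depends on t.\<close>

lemma poly_circle_lift_near:
  fixes p :: "complex poly" and g :: "real \<Rightarrow> complex"
  assumes deg: "degree p > 0" and g: "continuous_on {0..1} g" and "\<delta> > 0"
  shows "\<forall>\<^sub>F t in at 0 within {0..1}. \<forall>c. path c \<and> pathstart c = g t \<and>
     (\<forall>u\<in>{0..1}. dist (poly p (g 0)) (poly p (c u)) \<le> dist (poly p (g 0)) (poly p (g t))) \<longrightarrow> path_image c \<subseteq> ball (g 0) \<delta>"
proof -
  define v w where "v = g 0" and "w = poly p v"
  obtain \<mu> where \<mu>: "\<mu> > 0" "\<And>x y. poly p x = w \<Longrightarrow> poly p y = w \<Longrightarrow> x \<noteq> y \<Longrightarrow> \<mu> \<le> dist x y"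
    using poly_fibre_separated[OF deg] by blast
  define \<epsilon> where "\<epsilon> = min \<delta> (\<mu> / 2)"
  have \<epsilon>: "\<epsilon> > 0" "\<epsilon> \<le> \<delta>" "2 * \<epsilon> \<le> \<mu>" using \<mu>(1) \<open>\<delta> > 0\<close> by (auto simp: \<epsilon>_def)
  obtain \<eta> where \<eta>: "\<eta> > 0"
    "\<And>A z v. connected A \<Longrightarrow> poly p ` A \<subseteq> ball w \<eta> \<Longrightarrow> z \<in> A \<Longrightarrow> poly p v = w \<Longrightarrow>
       (\<And>v'. poly p v' = w \<Longrightarrow> v' \<noteq> v \<Longrightarrow> 2 * \<epsilon> \<le> dist v v') \<Longrightarrow> z \<in> ball v \<epsilon> \<Longrightarrow> A \<subseteq> ball v \<epsilon>"
    using poly_connected_near_preimage[OF deg \<epsilon>(1)] by metis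
  have lim: "(g \<longlongrightarrow> v) (at 0 within {0..1})"
    using g by (auto simp: continuous_on_def v_def)
  then have "\<forall>\<^sub>F t in at 0 within {0..1}. dist (g t) v < \<epsilon>"
    using \<epsilon>(1) by (rule tendstoD)
  moreover have "((\<lambda>t. poly p (g t)) \<longlongrightarrow> w) (at 0 within {0..1})"
    unfolding w_def using lim by (intro tendsto_intros)
  then have "\<forall>\<^sub>F t in at 0 within {0..1}. dist (poly p (g t)) w < \<eta>"
    using \<eta>(1) by (rule tendstoD)
  ultimately show ?thesis
  proof eventually_elim
    case (elim t)
    show ?case
    proof (intro allI impI, elim conjE)
      fix c assume c: "path c" "pathstart c = g t"
        "\<forall>u\<in>{0..1}. dist (poly p (g 0)) (poly p (c u)) \<le> dist (poly p (g 0)) (poly p (g t))"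
      have "path_image c \<subseteq> ball v \<epsilon>"
      proof (rule \<eta>(2))
        show "poly p ` path_image c \<subseteq> ball w \<eta>"
          using c(3) elim(2) by (fastforce simp: path_image_def v_def w_def dist_commute)
        show "pathstart c \<in> path_image c" by (rule pathstart_in_path_image)
        show "poly p v = w" by (simp add: w_def)
        show "2 * \<epsilon> \<le> dist v v'" if "poly p v' = w" "v' \<noteq> v" for v'
          using \<mu>(2)[of v v'] that \<epsilon>(3) by (auto simp: w_def)
        show "pathstart c \<in> ball v \<epsilon>" using c(2) elim(1) by (simp add: dist_commute)
      qed (use c in \<open>auto simp: connected_path_image\<close>)
      then show "path_image c \<subseteq> ball (g 0) \<delta>" using \<epsilon>(2) by (auto simp: v_def)
    qed
  qed
qed

section \<open>Circles, lassos and lifts of their pieces\<close>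

definition circle_from :: "complex \<Rightarrow> complex \<Rightarrow> real \<Rightarrow> complex" where
  "circle_from j a u = j + (a - j) * exp (2 * of_real pi * \<i> * of_real u)"

lemma circle_from:
  "path (circle_from j a)" "pathstart (circle_from j a) = a" "pathfinish (circle_from j a) = a"
  "dist j (circle_from j a u) = dist j a"
  "path_image (circle_from j a) \<subseteq> sphere j (dist j a)"
proof -
  show d: "dist j (circle_from j a u) = dist j a" for u
    by (simp add: circle_from_def dist_norm norm_mult norm_minus_commute)
  show "path (circle_from j a)"
    unfolding path_def circle_from_def[abs_def] by (intro continuous_intros)
  show "path_image (circle_from j a) \<subseteq> sphere j (dist j a)"
    using d by (auto simp: path_image_def)
qed (auto simp: pathstart_def pathfinish_def circle_from_def)

lemma lasso_eq: "lasso \<Lambda> j s t = subpath s t \<Lambda> +++ circle_from j (\<Lambda> t) +++ subpath t s \<Lambda>"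
  by (simp add: lasso_def circle_from_def[abs_def])

lemma is_lift_join:
  assumes "is_lift p \<alpha> h" "is_lift p \<beta> k" "pathfinish h = pathstart k"
  shows "is_lift p (\<alpha> +++ \<beta>) (h +++ k)"
  unfolding is_lift_def
proof (intro conjI ballI)
  show "path (h +++ k)" using assms by (intro path_join_imp) (auto simp: is_lift_def)
  show "p ((h +++ k) t) = (\<alpha> +++ \<beta>) t" if "t \<in> {0..1}" for t
    using that assms(1,2) by (auto simp: is_lift_def joinpaths_def)
qed

text \<open>Both orders of u and v are covered, since a lasso runs out along
  \<open>subpath s t\<close> and back along \<open>subpath t s\<close>.\<close>

lemma is_lift_subpath:
  assumes "is_lift p \<alpha> h" "u \<in> {0..1}" "v \<in> {0..1}"
  shows "is_lift p (subpath u v \<alpha>) (subpath u v h)"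
  unfolding is_lift_def
proof (intro conjI ballI)
  show "path (subpath u v h)" using assms by (intro path_subpath) (auto simp: is_lift_def)
  fix t :: real assume t: "t \<in> {0..1}"
  have "(v - u) * t + u \<in> closed_segment u v"
    using t unfolding closed_segment_def by (auto simp: algebra_simps intro!: exI[of _ t])
  then have "(v - u) * t + u \<in> {0..1}"
    using assms(2,3) by (auto simp: closed_segment_eq_real_ivl split: if_splits)
  then show "p (subpath u v h t) = subpath u v \<alpha> t"
    using assms(1) by (simp add: is_lift_def subpath_def)
qed

lemma path_image_join3_subset:
  assumes "path_image p \<subseteq> A" "path_image q \<subseteq> A" "path_image r \<subseteq> A"
  shows "path_image (p +++ q +++ r) \<subseteq> A"
  using path_image_join_subset[of p "q +++ r"] path_image_join_subset[of q r] assms by blast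

text \<open>Applied to \<Lambda> and to edges, this keeps both legs of a lasso and of its lift away
  from the vertices.\<close>

lemma path_image_subpath_inner:
  assumes "u \<in> {0<..<1}" "v \<in> {0<..<1::real}"
  shows "path_image (subpath u v g) \<subseteq> g ` {0<..<1}"
proof -
  have "closed_segment u v \<subseteq> {0<..<1}" using assms by (intro closed_segment_subset) auto
  then show ?thesis unfolding path_image_subpath_gen by (rule image_mono)
qed

lemma eventually_at_endpoint:
  assumes "j \<in> {0, 1::real}"
  shows "\<forall>\<^sub>F t in at j within {0..1}. t \<in> {0<..<1}"
  using assms unfolding eventually_at by (auto intro!: exI[of _ 1] simp: dist_real_def)

lemma eventually_at_endpoint_obtain:
  assumes "j \<in> {0, 1::real}" "\<forall>\<^sub>F t in at j within {0..1}. P t"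
  obtains t where "t \<in> {0<..<1}" "P t"
proof -
  have "at j within {0..1} \<noteq> bot"
    using assms(1) by (auto simp: at_within_Icc_at_left at_within_Icc_at_right)
  moreover have "\<forall>\<^sub>F t in at j within {0..1}. t \<in> {0<..<1} \<and> P t"
    using eventually_at_endpoint[OF assms(1)] assms(2) by (rule eventually_conj)
  ultimately show ?thesis using that eventually_happens by blast
qed

section \<open>The dynamical setting\<close>

text \<open>Subtracting the value does not change the derivative, and differentiation lowers the
  order of a zero by one.\<close>

lemma poly_pderiv_nonzero_if_local_degree_1:
  assumes "degree f > 0" "local_degree f z = 1"
  shows "poly (pderiv f) z \<noteq> 0"
proof
  assume 0: "poly (pderiv f) z = 0"
  define p where "p = f - [:poly f z:]"
  have dp: "pderiv p = pderiv f" by (simp add: p_def pderiv_diff pderiv_pCons)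
  have "pderiv f \<noteq> 0" using assms(1) by (simp add: pderiv_eq_0_iff)
  then have "p \<noteq> 0" using dp by auto
  have "order z p = Suc 0" using assms(2) by (simp add: local_degree_def p_def)
  moreover have "poly p z = 0" by (simp add: p_def)
  ultimately have "order z (pderiv f) = 0"
    using order_pderiv[of p z] \<open>p \<noteq> 0\<close> \<open>pderiv f \<noteq> 0\<close> by (simp add: dp)
  then show False
    using 0 \<open>pderiv f \<noteq> 0\<close> by (simp add: order_root)
qed

text \<open>The base point is carried as a parameter s of the arc, so that the fibre point of an
  edge with lift \<open>g\<close> is simply \<open>g s\<close>.\<close>

locale xdbp_dessin =
  fixes f :: "complex poly" and \<gamma>0 \<gamma>1 :: "complex set" and \<Lambda> :: "real \<Rightarrow> complex" and s :: real
  assumes f: "f \<in> XDBP"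
    and ray0: "closed_external_ray f 0 \<gamma>0" and ray1: "closed_external_ray f 1 \<gamma>1" and disj: "\<gamma>0 \<inter> \<gamma>1 = {}"
    and fray0: "poly f ` \<gamma>0 = \<gamma>0" and fray1: "poly f ` \<gamma>1 = \<gamma>0"
    and arc: "arc \<Lambda>" and start: "pathstart \<Lambda> = 0" and finish: "pathfinish \<Lambda> = 1"
    and inner: "\<Lambda> ` {0<..<1} \<subseteq> U f \<gamma>0 \<gamma>1 0"
    and s: "s \<in> {0<..<1}"
begin

abbreviation F :: "nat \<Rightarrow> complex \<Rightarrow> complex" where "F n \<equiv> poly f ^^ n"
abbreviation b :: complex where "b \<equiv> \<Lambda> s"
abbreviation U0 :: "complex set" where "U0 \<equiv> - (\<gamma>0 \<union> \<gamma>1)"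
abbreviation U1 :: "complex set" where "U1 \<equiv> poly f -` U0"
abbreviation E :: "complex set set" where "E \<equiv> dessin_edges f \<Lambda> 1"

lemma deg: "degree f \<ge> 3" and f_0: "poly f 0 = 0" and f_1: "poly f 1 = 0"
  and critical_value: "poly (pderiv f) z = 0 \<Longrightarrow> poly f z \<in> {0, 1}"
  using f by (auto simp: XDBP_def DBP_def critical_points_def)

lemma deg_pos: "degree f > 0" using deg by simp

lemma pderiv_f: "z \<in> {0, 1} \<Longrightarrow> poly (pderiv f) z \<noteq> 0"
  using f poly_pderiv_nonzero_if_local_degree_1[OF deg_pos] by (auto simp: XDBP_def)

lemma \<Lambda>_0: "\<Lambda> 0 = 0" and \<Lambda>_1: "\<Lambda> 1 = 1"
  using start finish by (auto simp: pathstart_def pathfinish_def)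

lemma path_\<Lambda>: "path \<Lambda>" using arc by (rule arc_imp_path)

lemma cont_\<Lambda>: "continuous_on {0..1} \<Lambda>" using path_\<Lambda> by (simp add: path_def)

lemma inj_\<Lambda>: "inj_on \<Lambda> {0..1}" using arc by (simp add: arc_def)

lemma \<Lambda>_U0: "t \<in> {0<..<1} \<Longrightarrow> \<Lambda> t \<in> U0"
  using inner unfolding U.simps by blast

lemma filled_julia_if_maps_to_0: "poly f v = 0 \<Longrightarrow> v \<in> filled_julia f"
proof -
  assume v: "poly f v = 0"
  have "(poly f ^^ n) v \<in> {v, 0}" for n
    by (induction n) (auto simp: v f_0)
  then have "range (\<lambda>n. (poly f ^^ n) v) \<subseteq> {v, 0}" by blast
  then show ?thesis
    unfolding filled_julia_def using finite_imp_bounded finite_subset by blast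
qed

lemma mem_rays:
  "0 \<in> \<gamma>0" "1 \<in> \<gamma>1" "0 \<notin> \<gamma>1" "1 \<notin> \<gamma>0"
  using ray0 ray1 disj by (auto simp: closed_external_ray_def)

lemma closed_rays: "closed \<gamma>0" "closed \<gamma>1"
  using closed_external_ray_closed[OF ray0] closed_external_ray_closed[OF ray1]
    filled_julia_if_maps_to_0 f_0 f_1 deg by auto

lemma open_U0: "open U0" using closed_rays by auto

lemma U0_01: "U0 \<subseteq> - {0, 1}" using mem_rays by auto

lemma simply_connected_U0: "simply_connected U0"
  by (rule simply_connected_complement_closed_external_rays[OF ray0 ray1 _ _ _ disj, of b])
    (use filled_julia_if_maps_to_0 f_0 f_1 deg \<Lambda>_U0[OF s] in auto)

lemma simply_connected_off_ray: "simply_connected (- \<gamma>0)" "simply_connected (- \<gamma>1)"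
  using simply_connected_complement_closed_external_ray[OF ray0, of 1]
    simply_connected_complement_closed_external_ray[OF ray1, of 0]
    mem_rays filled_julia_if_maps_to_0 f_0 f_1 deg by auto

text \<open>A zero of f has a bounded orbit, and a closed ray meets the filled Julia set only where
  it lands.\<close>

lemma zero_preimage_mem_U0:
  assumes "poly f v = 0" "v \<noteq> 0" "v \<noteq> 1"
  shows "v \<in> U0"
proof -
  have "\<gamma>0 \<inter> filled_julia f = {0}" "\<gamma>1 \<inter> filled_julia f = {1}"
    using closed_external_ray_inter_filled_julia[OF ray0] closed_external_ray_inter_filled_julia[OF ray1]
      filled_julia_if_maps_to_0 f_0 f_1 by auto
  then have "v \<notin> \<gamma>0" "v \<notin> \<gamma>1" using filled_julia_if_maps_to_0[OF assms(1)] assms(2,3) by (metis IntI singletonD)+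
  then show ?thesis by simp
qed

text \<open>Both rays are mapped into \<gamma>0, so a path that avoids \<gamma>0 alone has its lifts
  in \<open>U0\<close>. This is why a loop around 1 may cross \<gamma>1.\<close>

lemma U0_if_maps_off_ray0: "poly f z \<notin> \<gamma>0 \<Longrightarrow> z \<in> U0"
  using fray0 fray1 by blast

lemma U1_subset_U0: "U1 \<subseteq> U0"
  using U0_if_maps_off_ray0 by auto

text \<open>Pointwise form of the nesting of the sets U^n, obtained by stepping backwards along the
  orbit.\<close>

lemma F_preimage_antimono:
  assumes "F n z \<in> U0" "k \<le> n"
  shows "F k z \<in> U0"
  using \<open>k \<le> n\<close> \<open>F n z \<in> U0\<close>
proof (induction rule: inc_induct)
  case (step m)
  then show ?case using U0_if_maps_off_ray0[of "F m z"] by auto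
qed

lemma U_eq: "U f \<gamma>0 \<gamma>1 1 = U1"
  by simp

lemma f_01: "z \<in> {0, 1} \<Longrightarrow> poly f z \<in> {0, 1}"
  using f_0 f_1 by auto

lemma F_01_if:
  assumes "F k z \<in> {0, 1}" "k \<le> n"
  shows "F n z \<in> {0, 1}"
  using \<open>k \<le> n\<close> \<open>F k z \<in> {0, 1}\<close>
proof (induction rule: dec_induct)
  case (step m)
  then show ?case using f_01[of "F m z"] by simp
qed

text \<open>By the chain rule the orbit of a critical point of an iterate passes through a critical
  point of f, whose value is 0 or 1, and {0, 1} is forward invariant. The witness p makes results on
  \<open>poly\<close> applicable to functional powers.\<close>

lemma ex_poly_F:
  "\<exists>p. F n = poly p \<and> degree p > 0 \<and> (\<forall>z. F n z \<notin> {0, 1} \<longrightarrow> poly (pderiv p) z \<noteq> 0)"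
proof (induction n)
  case 0
  show ?case by (rule exI[of _ "[:0, 1:]"]) (auto simp: pderiv_pCons)
next
  case (Suc n)
  then obtain p where p: "F n = poly p" "degree p > 0" "\<And>z. F n z \<notin> {0, 1} \<Longrightarrow> poly (pderiv p) z \<noteq> 0"
    by blast
  have "poly (pderiv (pcompose f p)) z \<noteq> 0" if "F (Suc n) z \<notin> {0, 1}" for z
  proof -
    have "F n z \<notin> {0, 1}" using that F_01_if[of n z "Suc n"] by auto
    moreover have "poly (pderiv f) (F n z) \<noteq> 0" using critical_value[of "F n z"] that by auto
    ultimately show ?thesis using p(3) by (auto simp: pderiv_pcompose poly_pcompose p(1))
  qed
  then show ?case
    using p deg_pos by (intro exI[of _ "pcompose f p"]) (auto simp: poly_pcompose degree_pcompose)
qed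

lemma covering_space_F: "covering_space (F n -` (- {0, 1})) (F n) (- {0, 1})"
proof -
  obtain p where "F n = poly p" "degree p > 0" "\<And>z. F n z \<notin> {0, 1} \<Longrightarrow> poly (pderiv p) z \<noteq> 0"
    using ex_poly_F by blast
  then show ?thesis using covering_space_poly[of p "- {0, 1}"] by (simp add: open_Compl finite_imp_closed)
qed

text \<open>Over the simply connected \<open>U0\<close> this covering splits into inverse branches.
  It serves to name components, whereas loops are lifted by \<open>covering_space_F\<close>.\<close>

lemma covering_space_f: "covering_space U1 (poly f) U0"
  using deg_pos open_U0
proof (rule covering_space_poly)
  show "poly (pderiv f) z \<noteq> 0" if "poly f z \<in> U0" for z
    using critical_value[of z] that U0_01 by auto
qed

lemma cont_F: "continuous_on A (F n)"
  using ex_poly_F[of n] continuous_on_poly[OF continuous_on_id] by metis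

section \<open>Lifting paths\<close>

lemma lift_exists:
  assumes "path \<alpha>" "path_image \<alpha> \<subseteq> - {0, 1}" "F n x = pathstart \<alpha>"
  obtains h where "is_lift (F n) \<alpha> h" "pathstart h = x"
proof -
  have "x \<in> F n -` (- {0, 1})" using assms pathstart_in_path_image[of \<alpha>] by auto
  from covering_space_lift_path_strong[OF covering_space_F this assms(1,2)] show ?thesis
    using that assms(3) unfolding is_lift_def by metis
qed

lemma lift_path_image:
  assumes "is_lift (F n) \<alpha> h" "path_image \<alpha> \<subseteq> A"
  shows "path_image h \<subseteq> F n -` A"
  using assms by (auto simp: is_lift_def path_image_def)

text \<open>The loop \<alpha> is only known up to homotopy, so its monodromy is computed from the
  lift of a convenient representative \<beta>; the ends of the lifts agree by the monodromy
  theorem.\<close>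

lemma monodromy_eq_homotopic:
  assumes hom: "homotopic_paths (- {0, 1}) \<alpha> \<beta>" and h: "is_lift (F n) \<beta> h"
  shows "monodromy (F n) \<alpha> (pathstart h) = pathfinish h"
proof -
  have \<alpha>: "path \<alpha>" "path_image \<alpha> \<subseteq> - {0, 1}" and \<beta>: "path \<beta>" "path_image \<beta> \<subseteq> - {0, 1}"
    using homotopic_paths_imp_path[OF hom] homotopic_paths_imp_subset[OF hom] by auto
  have "F n (pathstart h) = pathstart \<beta>" using h by (auto simp: is_lift_def pathstart_def)
  also have "\<dots> = pathstart \<alpha>" using homotopic_paths_imp_pathstart[OF hom] by simp
  finally obtain k where k: "is_lift (F n) \<alpha> k" "pathstart k = pathstart h"
    using lift_exists[OF \<alpha>] by metis
  have eq: "pathfinish k' = pathfinish h" if "is_lift (F n) \<alpha> k'" "pathstart k' = pathstart h" for k'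
    by (rule covering_space_monodromy[OF covering_space_F \<alpha> \<beta> hom])
      (use that h lift_path_image[OF that(1) \<alpha>(2)] lift_path_image[OF h \<beta>(2)] in \<open>auto simp: is_lift_def\<close>)
  show ?thesis
    unfolding monodromy_def
    by (rule the_equality) (use k eq in blast)+
qed

lemma monodromy_eq:
  assumes "is_lift (F n) \<alpha> h" "path \<alpha>" "path_image \<alpha> \<subseteq> - {0, 1}"
  shows "monodromy (F n) \<alpha> (pathstart h) = pathfinish h"
  using monodromy_eq_homotopic[OF _ assms(1)] assms(2,3) by simp

lemma monodromy_homotopic:
  assumes hom: "homotopic_paths (- {0, 1}) \<alpha> \<beta>" and "F n x = pathstart \<alpha>"
  shows "monodromy (F n) \<alpha> x = monodromy (F n) \<beta> x"
proof -
  have \<beta>: "path \<beta>" "path_image \<beta> \<subseteq> - {0, 1}"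
    using homotopic_paths_imp_path[OF hom] homotopic_paths_imp_subset[OF hom] by auto
  obtain h where "is_lift (F n) \<beta> h" "pathstart h = x"
    using lift_exists[OF \<beta>] assms homotopic_paths_imp_pathstart[OF hom] by metis
  then show ?thesis
    using monodromy_eq_homotopic[OF hom] monodromy_eq[OF _ \<beta>] by metis
qed

lemma F_monodromy:
  assumes "path \<alpha>" "path_image \<alpha> \<subseteq> - {0, 1}" "F n x = pathstart \<alpha>"
  shows "F n (monodromy (F n) \<alpha> x) = pathfinish \<alpha>"
proof -
  obtain h where h: "is_lift (F n) \<alpha> h" "pathstart h = x" using lift_exists[OF assms] .
  then show ?thesis
    using monodromy_eq[OF h(1) assms(1,2)] by (auto simp: is_lift_def pathfinish_def)
qed

lemma monodromy_join:
  assumes \<alpha>: "path \<alpha>" "path_image \<alpha> \<subseteq> - {0, 1}" "F n x = pathstart \<alpha>"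
    and \<beta>: "path \<beta>" "path_image \<beta> \<subseteq> - {0, 1}" "pathfinish \<alpha> = pathstart \<beta>"
  shows "monodromy (F n) (\<alpha> +++ \<beta>) x = monodromy (F n) \<beta> (monodromy (F n) \<alpha> x)"
proof -
  obtain h where h: "is_lift (F n) \<alpha> h" "pathstart h = x" using lift_exists[OF \<alpha>] .
  have hf: "monodromy (F n) \<alpha> x = pathfinish h" using monodromy_eq[OF h(1) \<alpha>(1,2)] h(2) by simp
  have "F n (pathfinish h) = pathstart \<beta>"
    using F_monodromy[OF \<alpha>] \<beta>(3) hf by simp
  then obtain k where k: "is_lift (F n) \<beta> k" "pathstart k = pathfinish h" by (rule lift_exists[OF \<beta>(1,2)])
  have "is_lift (F n) (\<alpha> +++ \<beta>) (h +++ k)"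
    using h(1) k by (intro is_lift_join) auto
  moreover have "path (\<alpha> +++ \<beta>)" "path_image (\<alpha> +++ \<beta>) \<subseteq> - {0, 1}"
    using \<alpha> \<beta> by (auto simp: path_image_join)
  ultimately have "monodromy (F n) (\<alpha> +++ \<beta>) (pathstart (h +++ k)) = pathfinish (h +++ k)"
    by (rule monodromy_eq)
  also have "\<dots> = monodromy (F n) \<beta> (pathfinish h)"
    using monodromy_eq[OF k(1) \<beta>(1,2)] k(2) by simp
  finally show ?thesis using h(2) hf by simp
qed

text \<open>Since f maps {0, 1} into itself, a lift under f again runs in the region over which
  iterates are coverings and can be lifted once more.\<close>

lemma lift_f_avoids_01:
  assumes "is_lift (poly f) \<alpha> h" "path_image \<alpha> \<subseteq> - {0, 1}"
  shows "path_image h \<subseteq> - {0, 1}"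
proof -
  have "path_image h \<subseteq> poly f -` (- {0, 1})"
    using lift_path_image[of 1 \<alpha> h "- {0, 1}"] assms by (simp add: o_def id_def)
  then show ?thesis using f_01 by auto
qed

lemma monodromy_Suc:
  assumes h: "is_lift (poly f) \<alpha> h" "F n x = pathstart h" and \<alpha>: "path \<alpha>" "path_image \<alpha> \<subseteq> - {0, 1}"
  shows "monodromy (F (Suc n)) \<alpha> x = monodromy (F n) h x"
proof -
  have "path h" using h by (simp add: is_lift_def)
  then obtain k where k: "is_lift (F n) h k" "pathstart k = x"
    using lift_exists[OF _ lift_f_avoids_01[OF h(1) \<alpha>(2)] h(2)] by metis
  have "is_lift (F (Suc n)) \<alpha> k" using h(1) k by (auto simp: is_lift_def)
  then show ?thesis
    using monodromy_eq[OF _ \<alpha>] monodromy_eq[OF k(1) \<open>path h\<close> lift_f_avoids_01[OF h(1) \<alpha>(2)]] k(2) by metis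
qed

lemma F_monodromy_Suc:
  assumes \<alpha>: "path \<alpha>" "path_image \<alpha> \<subseteq> - {0, 1}" and x: "F (Suc n) x = pathstart \<alpha>"
  shows "F n (monodromy (F (Suc n)) \<alpha> x) = monodromy (poly f) \<alpha> (F n x)"
proof -
  obtain h where h: "is_lift (F 1) \<alpha> h" "pathstart h = F n x"
    using lift_exists[OF \<alpha>, of 1 "F n x"] x by auto
  have h': "is_lift (poly f) \<alpha> h" using h(1) by simp
  then have "path h" by (simp add: is_lift_def)
  have "F n (monodromy (F n) h x) = pathfinish h"
    by (rule F_monodromy[OF \<open>path h\<close> lift_f_avoids_01[OF h' \<alpha>(2)]]) (simp add: h)
  also have "\<dots> = monodromy (poly f) \<alpha> (F n x)"
    using monodromy_eq[OF h(1) \<alpha>] h(2) by simp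
  finally show ?thesis using monodromy_Suc[OF h' h(2)[symmetric] \<alpha>] by simp
qed

section \<open>Edges\<close>

text \<open>The open interval is simply connected, so \<Lambda> lifts over it through x; over 0 and
  1, where \<open>F n\<close> may branch, the ends are limits given by
  \<open>poly_lift_tendsto\<close>. The parameter r is arbitrary because the edges at 0 and 1 are
  found from a point near the vertex.\<close>

lemma edge_lift_exists:
  assumes "F n x = \<Lambda> r" and r: "r \<in> {0<..<1}"
  obtains g where "is_lift (F n) \<Lambda> g" "g r = x"
proof -
  obtain p where p: "F n = poly p" "degree p > 0" using ex_poly_F by blast
  have "x \<in> F n -` (- {0, 1})" using assms \<Lambda>_U0[OF r] U0_01 by auto
  moreover have "simply_connected {0<..<1::real}" "locally path_connected {0<..<1::real}"
    by (auto simp: convex_imp_simply_connected convex_imp_locally_path_connected)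
  moreover have "continuous_on {0<..<1} \<Lambda>" using cont_\<Lambda> by (rule continuous_on_subset) auto
  moreover have "\<Lambda> \<in> {0<..<1} \<rightarrow> - {0, 1}" using \<Lambda>_U0 U0_01 by blast
  ultimately obtain g where g: "continuous_on {0<..<1} g" "g r = x" "\<And>t. t \<in> {0<..<1} \<Longrightarrow> F n (g t) = \<Lambda> t"
    using covering_space_lift_strong[OF covering_space_F[of n] _ r, of x \<Lambda>] assms by metis
  have lim: "((\<lambda>t. poly p (g t)) \<longlongrightarrow> \<Lambda> a) (at a within {0<..<1})" if "a \<in> {0..1}" for a
  proof -
    have "(\<Lambda> \<longlongrightarrow> \<Lambda> a) (at a within {0<..<1})"
      using cont_\<Lambda> that unfolding continuous_on_def by (rule_tac tendsto_within_subset) auto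
    moreover have "\<forall>\<^sub>F t in at a within {0<..<1}. \<Lambda> t = poly p (g t)"
      using g(3) by (auto simp: eventually_at_filter p(1))
    ultimately show ?thesis by (rule Lim_transform_eventually)
  qed
  obtain v0 where v0: "poly p v0 = \<Lambda> 0" "(g \<longlongrightarrow> v0) (at 0 within {0<..<1})"
    by (rule poly_lift_tendsto[OF p(2) _ _ _ g(1) lim[of 0]]) auto
  obtain v1 where v1: "poly p v1 = \<Lambda> 1" "(g \<longlongrightarrow> v1) (at 1 within {0<..<1})"
    by (rule poly_lift_tendsto[OF p(2) _ _ _ g(1) lim[of 1]]) auto
  define h where "h t = (if t = 0 then v0 else if t = 1 then v1 else g t)" for t
  have "(h \<longlongrightarrow> h a) (at a within {0..1})" if "a \<in> {0..1}" for a
  proof -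
    have ev: "\<forall>\<^sub>F t in at a within {0<..<1}. g t = h t"
      by (auto simp: eventually_at_filter h_def)
    have "(g \<longlongrightarrow> h a) (at a within {0<..<1})"
    proof -
      have "a = 0 \<or> a = 1 \<or> a \<in> {0<..<1}" using that by auto
      then show ?thesis
        using v0 v1 g(1) by (elim disjE) (auto simp: h_def continuous_on_def)
    qed
    then have "(h \<longlongrightarrow> h a) (at a within {0<..<1})"
      using ev by (rule Lim_transform_eventually)
    moreover have "at a within {0..1} = at a within {0<..<1}"
    proof -
      have "a = 0 \<or> a = 1 \<or> a \<in> {0<..<1}" using that by auto
      then show ?thesis
      proof (elim disjE)
        assume "a = 0" then show ?thesis by (intro at_within_nhd[of _ "{-1<..<1}"]) auto
      next
        assume "a = 1" then show ?thesis by (intro at_within_nhd[of _ "{0<..<2}"]) auto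
      next
        assume "a \<in> {0<..<1}" then show ?thesis by (intro at_within_nhd[of _ "{0<..<1}"]) auto
      qed
    qed
    ultimately show ?thesis by simp
  qed
  then have "path h" by (simp add: path_def continuous_on_def)
  moreover have "F n (h t) = \<Lambda> t" if "t \<in> {0..1}" for t
    using that g(3)[of t] v0 v1 by (auto simp: h_def p(1))
  ultimately have "is_lift (F n) \<Lambda> h" by (simp add: is_lift_def)
  moreover have "h r = x" using r g(2) by (simp add: h_def)
  ultimately show ?thesis by (rule that)
qed

text \<open>Unique lifting works over the open interval; by continuity the agreement passes to the
  end points. Agreement is assumed at an interior parameter because several edges can share a
  vertex.\<close>

lemma edge_lift_unique:
  assumes g: "is_lift (F n) \<Lambda> g" and h: "is_lift (F n) \<Lambda> h" and eq: "g t = h t" "t \<in> {0<..<1}" and u: "u \<in> {0..1}"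
  shows "g u = h u"
proof -
  have *: "continuous_on {0<..<1} g" "continuous_on {0<..<1} h" "continuous_on {0..1} g" "continuous_on {0..1} h"
    using g h by (auto simp: is_lift_def path_def intro: continuous_on_subset)
  have mem: "k r \<in> F n -` (- {0, 1})" if "is_lift (F n) \<Lambda> k" "r \<in> {0<..<1}" for k r
    using that \<Lambda>_U0[OF that(2)] U0_01 by (auto simp: is_lift_def)
  have eq1: "g u = h u" if "u \<in> {0<..<1}" for u
  proof (rule covering_space_lift_unique[where f = \<Lambda> and T = "{0<..<1}" and a = t and ?g1.0 = g and ?g2.0 = h, OF covering_space_F[of n] eq(1)])
    show "continuous_on {0<..<1} \<Lambda>" using cont_\<Lambda> by (rule continuous_on_subset) auto
    show "\<Lambda> \<in> {0<..<1} \<rightarrow> - {0, 1}" using \<Lambda>_U0 U0_01 by blast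
    show "g \<in> {0<..<1} \<rightarrow> F n -` (- {0, 1})" "h \<in> {0<..<1} \<rightarrow> F n -` (- {0, 1})" using mem g h by blast+
  qed (use * eq that g h in \<open>auto simp: is_lift_def\<close>)
  have "u \<in> closure {0<..<1}" using u by simp
  moreover have "closed {r \<in> {0..1}. g r - h r = 0}"
    using * by (intro continuous_closed_preimage_constant continuous_intros) auto
  then have "closed {r \<in> {0..1}. g r = h r}" by simp
  then have "closure {0<..<1} \<subseteq> {r \<in> {0..1}. g r = h r}"
    by (rule closure_minimal[rotated]) (use eq1 in auto)
  ultimately show ?thesis by blast
qed

text \<open>Names an edge by its point over the base point. The choice of \<open>g\<close> is
  harmless, since two lifts through x at parameter s have the same image.\<close>

definition edge :: "nat \<Rightarrow> complex \<Rightarrow> complex set" where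
  "edge n x = path_image (SOME g. is_lift (F n) \<Lambda> g \<and> g s = x)"

lemma edge_eq:
  assumes g: "is_lift (F n) \<Lambda> g"
  shows "edge n (g s) = path_image g"
proof -
  define h where "h = (SOME h. is_lift (F n) \<Lambda> h \<and> h s = g s)"
  have h: "is_lift (F n) \<Lambda> h \<and> h s = g s"
    unfolding h_def by (rule someI[of _ g]) (use g in simp)
  have "h u = g u" if "u \<in> {0..1}" for u
    using edge_lift_unique[OF _ g _ s that] h by blast
  then show ?thesis
    unfolding edge_def h_def[symmetric] by (simp add: path_image_def)
qed

lemma edge_mem: "F n x = b \<Longrightarrow> edge n x \<in> dessin_edges f \<Lambda> n"
  using edge_lift_exists[OF _ s, of n x] edge_eq unfolding dessin_edges_def by (metis (mono_tags, lifting) mem_Collect_eq)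

lemma dessin_edge_cases:
  assumes "X \<in> dessin_edges f \<Lambda> n"
  obtains x where "F n x = b" "X = edge n x"
proof -
  obtain g where g: "X = path_image g" "is_lift (F n) \<Lambda> g" using assms by (auto simp: dessin_edges_def)
  then have "F n (g s) = b" using s by (auto simp: is_lift_def)
  then show ?thesis using that edge_eq g by metis
qed

text \<open>\<Lambda> is injective, so an edge passes over the base point only at parameter
  s.\<close>

lemma edge_inter_fibre:
  assumes "F n x = b"
  shows "y \<in> edge n x \<and> F n y = b \<longleftrightarrow> y = x"
proof -
  obtain g where g: "is_lift (F n) \<Lambda> g" "g s = x" using edge_lift_exists[OF assms s] .
  have "t = s" if "t \<in> {0..1}" "F n (g t) = b" for t
    using that g s inj_onD[OF inj_\<Lambda>, of t s] by (auto simp: is_lift_def)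
  then have "y = x" if "y \<in> edge n x" "F n y = b"
    using that edge_eq[OF g(1)] g(2) by (metis path_image_def imageE)
  moreover have "x \<in> edge n x" using edge_eq[OF g(1)] g(2) s by (auto simp: path_image_def)
  ultimately show ?thesis using assms by blast
qed

lemma edge_inj: "F n x = b \<Longrightarrow> F n y = b \<Longrightarrow> edge n x = edge n y \<Longrightarrow> x = y"
  using edge_inter_fibre[of n x y] edge_inter_fibre[of n y y] by simp

lemma edge_interior_eq:
  assumes g: "is_lift (F n) \<Lambda> g"
  shows "edge_interior f n (path_image g) = g ` {0<..<1}"
proof -
  have "F n (g t) \<in> {0, 1} \<longleftrightarrow> t = 0 \<or> t = 1" if "t \<in> {0..1}" for t
  proof (cases "t \<in> {0<..<1}")
    case True
    then show ?thesis using g \<Lambda>_U0[OF True] U0_01 by (auto simp: is_lift_def)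
  next
    case False
    then show ?thesis using g that by (auto simp: is_lift_def \<Lambda>_0 \<Lambda>_1)
  qed
  note * = this
  show ?thesis
  proof (intro equalityI subsetI)
    fix z assume "z \<in> edge_interior f n (path_image g)"
    then obtain t where "t \<in> {0..1}" "z = g t" "F n (g t) \<notin> {0, 1}"
      by (auto simp: edge_interior_def path_image_def)
    moreover from this have "t \<in> {0<..<1}" using *[of t] by auto
    ultimately show "z \<in> g ` {0<..<1}" by blast
  next
    fix z assume "z \<in> g ` {0<..<1}"
    then obtain t where t: "t \<in> {0<..<1}" "z = g t" by blast
    then have "t \<in> {0..1}" "F n (g t) \<notin> {0, 1}" using *[of t] by auto
    then show "z \<in> edge_interior f n (path_image g)"
      using t(2) by (auto simp: edge_interior_def path_image_def)
  qed
qed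

lemma edge_monodromy_edge:
  assumes \<alpha>: "path \<alpha>" "path_image \<alpha> \<subseteq> - {0, 1}" "pathstart \<alpha> = b" "pathfinish \<alpha> = b" and x: "F n x = b"
  shows "edge_monodromy f \<Lambda> b \<alpha> n (edge n x) = edge n (monodromy (F n) \<alpha> x)"
proof -
  have x': "(THE y. y \<in> edge n x \<and> F n y = b) = x"
    using edge_inter_fibre[OF x] by simp
  define y where "y = monodromy (F n) \<alpha> x"
  have y: "F n y = b" using F_monodromy[OF \<alpha>(1,2), of n x] \<alpha> x by (simp add: y_def)
  show ?thesis
    unfolding edge_monodromy_def x' y_def[symmetric]
  proof (rule the_equality)
    show "edge n y \<in> dessin_edges f \<Lambda> n \<and> y \<in> edge n y"
      using edge_mem[OF y] edge_inter_fibre[OF y, of y] y by simp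
    fix Y assume Y: "Y \<in> dessin_edges f \<Lambda> n \<and> y \<in> Y"
    then obtain z where "F n z = b" "Y = edge n z" using dessin_edge_cases by metis
    then show "Y = edge n y" using Y y edge_inter_fibre[of n z y] by simp
  qed
qed

section \<open>Itineraries\<close>

text \<open>Lifting the identity of the simply connected \<open>U0\<close> gives the inverse branch
  of f through z.\<close>

lemma f_section:
  assumes "z \<in> U1"
  obtains \<sigma> where "continuous_on U0 \<sigma>" "\<sigma> ` U0 \<subseteq> U1" "\<sigma> (poly f z) = z" "\<And>w. w \<in> U0 \<Longrightarrow> poly f (\<sigma> w) = w"
proof -
  have "poly f z \<in> U0" using assms by simp
  moreover have "locally path_connected U0" using open_U0 by (rule open_imp_locally_path_connected)
  ultimately obtain \<sigma> where "continuous_on U0 \<sigma>" "\<sigma> \<in> U0 \<rightarrow> U1" "\<sigma> (poly f z) = z" "\<And>w. w \<in> U0 \<Longrightarrow> poly f (\<sigma> w) = w"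
    by (rule covering_space_lift_strong[OF covering_space_f assms _ simply_connected_U0, of "poly f z" "\<lambda>w. w"])
      (use continuous_on_id in blast)+
  then show ?thesis using that[of \<sigma>] by blast
qed

text \<open>On C both the identity and the inverse branch composed with f lift f, and they agree at
  z, hence also at z'.\<close>

lemma component_fibre_unique:
  assumes C: "C \<in> components U1" and z: "z \<in> C" "z' \<in> C" "poly f z = poly f z'"
  shows "z = z'"
proof -
  have CU: "C \<subseteq> U1" using C by (rule in_components_subset)
  then obtain \<sigma> where \<sigma>: "continuous_on U0 \<sigma>" "\<sigma> ` U0 \<subseteq> U1" "\<sigma> (poly f z) = z" "\<And>w. w \<in> U0 \<Longrightarrow> poly f (\<sigma> w) = w"
    using f_section[of z] z(1) by blast
  have "(\<lambda>x. \<sigma> (poly f x)) z' = (\<lambda>x. x) z'"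
  proof (rule covering_space_lift_unique[where a = z and T = C and f = "poly f", OF covering_space_f])
    show "continuous_on C (\<lambda>x. \<sigma> (poly f x))"
      by (rule continuous_on_compose2[OF \<sigma>(1)]) (use CU in \<open>auto intro!: continuous_intros\<close>)
    show "connected C" using C by (rule in_components_connected)
    show "(\<lambda>x. \<sigma> (poly f x)) \<in> C \<rightarrow> U1" "poly f \<in> C \<rightarrow> U0" "(\<lambda>x. x) \<in> C \<rightarrow> U1"
      using CU \<sigma>(2) by blast+
    show "poly f x = poly f (\<sigma> (poly f x))" if "x \<in> C" for x
      using \<sigma>(4)[of "poly f x"] that CU by (metis subsetD vimageD)
  qed (use \<sigma>(3) z in \<open>auto intro!: continuous_intros\<close>)
  then show ?thesis using \<sigma>(3) z(3) by simp
qed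

text \<open>The inverse branch through a point of C has connected image, which therefore stays in C
  and meets every fibre over \<open>U0\<close>.\<close>

lemma component_fibre_exists:
  assumes C: "C \<in> components U1" and w: "w \<in> U0"
  obtains z where "z \<in> C" "poly f z = w"
proof -
  obtain z where z: "z \<in> C" using C in_components_nonempty by blast
  then have "z \<in> U1" using C in_components_subset by blast
  then obtain \<sigma> where \<sigma>: "continuous_on U0 \<sigma>" "\<sigma> ` U0 \<subseteq> U1" "\<sigma> (poly f z) = z" "\<And>w. w \<in> U0 \<Longrightarrow> poly f (\<sigma> w) = w"
    using f_section[of z] by blast
  have "connected U0" using simply_connected_U0 by (rule simply_connected_imp_connected)
  then have "connected (\<sigma> ` U0)" using \<sigma>(1) by (rule connected_continuous_image[rotated])
  moreover have "z \<in> \<sigma> ` U0" using \<sigma>(3) \<open>z \<in> U1\<close> by (metis image_eqI vimageE)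
  ultimately have "\<sigma> ` U0 \<subseteq> C"
    using components_maximal[OF C _ \<sigma>(2)] z by blast
  then show ?thesis using that[of "\<sigma> w"] \<sigma>(4) w by blast
qed

section \<open>Components of \<open>U1\<close> named by edges\<close>

lemma component_exists:
  assumes "z \<in> U1"
  obtains C where "C \<in> components U1" "z \<in> C"
  using assms componentsI[of z U1] connected_component_refl by (metis connected_component_refl_eq mem_Collect_eq)

lemma component_unique: "C \<in> components U1 \<Longrightarrow> C' \<in> components U1 \<Longrightarrow> z \<in> C \<Longrightarrow> z \<in> C' \<Longrightarrow> C = C'"
  using components_nonoverlap by blast

text \<open>Turns the condition on sets in \<open>itinerary\<close> into one on the fibre point: the
  image of the open edge is connected and contains F k x. Strictness of k < n matters, because it
  places the image in \<open>U1\<close> and not merely in \<open>U0\<close>.\<close>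

lemma image_edge_interior_subset_iff:
  assumes x: "F n x = b" and C: "C \<in> components U1" and "k < n"
  shows "F k ` edge_interior f n (edge n x) \<subseteq> C \<longleftrightarrow> F k x \<in> C"
proof -
  obtain g where g: "is_lift (F n) \<Lambda> g" "g s = x" using edge_lift_exists[OF x s] .
  have int: "edge_interior f n (edge n x) = g ` {0<..<1}"
    using edge_interior_eq[OF g(1)] edge_eq[OF g(1)] g(2) by simp
  define A where "A = F k ` g ` {0<..<1}"
  have "continuous_on {0<..<1} g" using g(1) by (auto simp: is_lift_def path_def intro: continuous_on_subset)
  then have "connected A"
    unfolding A_def by (intro connected_continuous_image cont_F) auto
  moreover have "A \<subseteq> U1"
  proof -
    have "F k (g t) \<in> U1" if t: "t \<in> {0<..<1}" for t
    proof -
      have "F n (g t) \<in> U0" using g(1) t \<Lambda>_U0[OF t] by (auto simp: is_lift_def)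
      then have "F (Suc k) (g t) \<in> U0" by (rule F_preimage_antimono) (use \<open>k < n\<close> in simp)
      then show ?thesis by simp
    qed
    then show ?thesis by (auto simp: A_def)
  qed
  moreover have "F k x \<in> A" using s g(2) by (auto simp: A_def)
  ultimately show ?thesis
    unfolding int A_def[symmetric] using components_maximal[OF C, of A] by blast
qed

lemma edge_interior_subset_iff:
  assumes "poly f y = b" "C \<in> components U1"
  shows "edge_interior f 1 (edge 1 y) \<subseteq> C \<longleftrightarrow> y \<in> C"
  using image_edge_interior_subset_iff[of 1 y C 0] assms by simp

text \<open>The itinerary entry belonging to a single point. Since it needs no edge of an iterate,
  entries can be compared along arbitrary paths in \<open>U1\<close>.\<close>

definition label :: "complex \<Rightarrow> complex set" where
  "label z = (THE e. e \<in> E \<and> (\<exists>C \<in> components U1. edge_interior f 1 e \<subseteq> C \<and> z \<in> C))"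

lemma label_eq:
  assumes C: "C \<in> components U1" "z \<in> C" "y \<in> C" and y: "poly f y = b"
  shows "label z = edge 1 y"
  unfolding label_def
proof (rule the_equality)
  show "edge 1 y \<in> E \<and> (\<exists>C\<in>components U1. edge_interior f 1 (edge 1 y) \<subseteq> C \<and> z \<in> C)"
    using edge_mem[of 1 y] y edge_interior_subset_iff[OF y C(1)] C by auto
  fix e assume e: "e \<in> E \<and> (\<exists>C\<in>components U1. edge_interior f 1 e \<subseteq> C \<and> z \<in> C)"
  then obtain y' where y': "poly f y' = b" "e = edge 1 y'"
    using dessin_edge_cases[of e 1] by auto
  then have "y' \<in> C"
    using e edge_interior_subset_iff[OF y'(1)] component_unique[OF C(1) _ C(2)] by metis
  then show "e = edge 1 y"
    using component_fibre_unique[OF C(1) C(3), of y'] y y' by simp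
qed

lemma label_cases:
  assumes "z \<in> U1"
  obtains C y where "C \<in> components U1" "z \<in> C" "y \<in> C" "poly f y = b" "label z = edge 1 y"
proof -
  obtain C where C: "C \<in> components U1" "z \<in> C" using component_exists[OF assms] .
  obtain y where "y \<in> C" "poly f y = b" using component_fibre_exists[OF C(1) \<Lambda>_U0[OF s]] .
  then show ?thesis using that C label_eq by blast
qed

lemma label_fibre: "poly f y = b \<Longrightarrow> label y = edge 1 y"
  using label_eq component_exists[of y] \<Lambda>_U0[OF s] by (metis vimageI)

lemma label_const:
  assumes "connected A" "A \<subseteq> U1" "z \<in> A" "z' \<in> A"
  shows "label z = label z'"
proof -
  have "z \<in> U1" using assms by blast
  then obtain C y where C: "C \<in> components U1" "z \<in> C" "y \<in> C" "poly f y = b" "label z = edge 1 y"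
    by (rule label_cases)
  then have "A \<subseteq> C" using components_maximal[OF C(1) assms(1,2)] assms(3) by blast
  then show ?thesis using label_eq[OF C(1) _ C(3,4), of z'] assms(4) C(5) by auto
qed

text \<open>A label determines a component, and f is injective on each component.\<close>

lemma label_inj:
  assumes "z \<in> U1" "z' \<in> U1" "label z = label z'" "poly f z = poly f z'"
  shows "z = z'"
proof -
  obtain C y where C: "C \<in> components U1" "z \<in> C" "y \<in> C" "poly f y = b" "label z = edge 1 y"
    using label_cases[OF assms(1)] .
  obtain C' y' where C': "C' \<in> components U1" "z' \<in> C'" "y' \<in> C'" "poly f y' = b" "label z' = edge 1 y'"
    using label_cases[OF assms(2)] .
  have "y = y'" using edge_inj[of 1 y y'] C C' assms(3) by simp
  then have "C = C'" using component_unique[OF C(1) C'(1)] C C' by blast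
  then show ?thesis using component_fibre_unique[OF C(1,2)] C' assms(4) by blast
qed

lemma label_surj:
  assumes "e \<in> E" "w \<in> U0"
  obtains z where "poly f z = w" "label z = e"
proof -
  obtain y where y: "poly f y = b" "e = edge 1 y" using dessin_edge_cases[OF assms(1)] by auto
  have "y \<in> U1" using y \<Lambda>_U0[OF s] by simp
  then obtain C where C: "C \<in> components U1" "y \<in> C" by (rule component_exists)
  obtain z where "z \<in> C" "poly f z = w" using component_fibre_exists[OF C(1) assms(2)] .
  then show ?thesis using that[of z] label_eq[OF C(1) _ C(2) y(1)] y(2) by blast
qed

definition itin :: "nat \<Rightarrow> complex \<Rightarrow> complex set list" where
  "itin n x = map (\<lambda>k. label (F k x)) [0..<n]"

lemma itin_Suc: "itin (Suc n) x = itin n x @ [label (F n x)]"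
  by (simp add: itin_def)

lemma itin_Suc_Cons: "itin (Suc n) x = label x # itin n (poly f x)"
  by (simp add: itin_def map_upt_Suc funpow_swap1 del: upt_Suc)

lemma itinerary_edge:
  assumes x: "F n x = b"
  shows "itinerary f \<gamma>0 \<gamma>1 \<Lambda> n (edge n x) = itin n x"
  unfolding itinerary_def itin_def label_def U_eq
  by (rule map_cong) (use image_edge_interior_subset_iff[OF x] in \<open>auto cong: conj_cong\<close>)

text \<open>Downward induction along the orbit: equal points at time k + 1 and equal labels at time
  k give equal points at time k.\<close>

lemma itin_inj:
  assumes x: "F n x = b" "F n x' = b" and eq: "itin n x = itin n x'"
  shows "x = x'"
proof -
  have "F k x = F k x'" if "k \<le> n" for k
    using that
  proof (induction rule: inc_induct)
    case (step k)
    have "F (Suc k) x \<in> U0" "F (Suc k) x' \<in> U0"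
      using F_preimage_antimono[of n _ "Suc k"] x \<Lambda>_U0[OF s] step.hyps by auto
    moreover have "label (F k x) = label (F k x')"
      using arg_cong[OF eq, of "\<lambda>l. l ! k"] step.hyps by (simp add: itin_def)
    ultimately show ?case
      using label_inj[of "F k x" "F k x'"] step.IH by simp
  qed (use x in simp)
  from this[of 0] show ?thesis by simp
qed

text \<open>Prepending an entry means choosing one more preimage with that label, which is possible
  since the point found so far lies in \<open>U0\<close>.\<close>

lemma itin_surj:
  assumes "set es \<subseteq> E" "w \<in> U0"
  shows "\<exists>x. F (length es) x = w \<and> itin (length es) x = es"
  using assms(1)
proof (induction es)
  case (Cons e es)
  then obtain x' where x': "F (length es) x' = w" "itin (length es) x' = es" by auto
  then have "x' \<in> U0" using F_preimage_antimono[of "length es" x' 0] assms(2) by simp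
  then obtain x where "poly f x = x'" "label x = e" using label_surj[of e x'] Cons.prems by auto
  then show ?case
    using x' by (intro exI[of _ x]) (simp add: itin_Suc_Cons funpow_swap1)
qed (use assms(2) in \<open>simp add: itin_def\<close>)

lemma itinerary_monodromy_itin:
  assumes \<alpha>: "path \<alpha>" "path_image \<alpha> \<subseteq> - {0, 1}" "pathstart \<alpha> = b" "pathfinish \<alpha> = b" and x: "F n x = b"
  shows "itinerary_monodromy f \<gamma>0 \<gamma>1 \<Lambda> b \<alpha> n (itin n x) = itin n (monodromy (F n) \<alpha> x)"
proof -
  have "inj_on (itinerary f \<gamma>0 \<gamma>1 \<Lambda> n) (dessin_edges f \<Lambda> n)"
  proof (rule inj_onI)
    fix X Y assume "X \<in> dessin_edges f \<Lambda> n" "Y \<in> dessin_edges f \<Lambda> n"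
      and eq: "itinerary f \<gamma>0 \<gamma>1 \<Lambda> n X = itinerary f \<gamma>0 \<gamma>1 \<Lambda> n Y"
    then obtain x y where "F n x = b" "X = edge n x" "F n y = b" "Y = edge n y"
      using dessin_edge_cases by metis
    then show "X = Y" using itin_inj[of n x y] itinerary_edge eq by simp
  qed
  then have "the_inv_into (dessin_edges f \<Lambda> n) (itinerary f \<gamma>0 \<gamma>1 \<Lambda> n) (itin n x) = edge n x"
    using itinerary_edge[OF x] edge_mem[OF x] by (rule the_inv_into_f_eq)
  moreover have "F n (monodromy (F n) \<alpha> x) = b"
    using F_monodromy[OF \<alpha>(1,2), of n x] \<alpha> x by simp
  ultimately show ?thesis
    by (simp add: itinerary_monodromy_def edge_monodromy_edge[OF \<alpha> x] itinerary_edge)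
qed

text \<open>For k < n the k-th image of the lift is a connected subset of \<open>U1\<close>, so its
  label is constant. The statement is about paths with arbitrary ends because it is also applied to
  the connecting path \<tau> and its reverse.\<close>

lemma itin_monodromy_in_U0:
  assumes \<alpha>: "path \<alpha>" "path_image \<alpha> \<subseteq> U0" and x: "F n x = pathstart \<alpha>"
  shows "itin n (monodromy (F n) \<alpha> x) = itin n x"
proof -
  have \<alpha>': "path_image \<alpha> \<subseteq> - {0, 1}" using \<alpha>(2) U0_01 by blast
  obtain h where h: "is_lift (F n) \<alpha> h" "pathstart h = x" using lift_exists[OF \<alpha>(1) \<alpha>' x] .
  have "path h" using h(1) by (simp add: is_lift_def)
  have "label (F k (pathfinish h)) = label (F k (pathstart h))" if "k < n" for k
  proof (rule label_const)
    show "connected (F k ` path_image h)"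
      using \<open>path h\<close> by (intro connected_continuous_image cont_F connected_path_image)
    show "F k ` path_image h \<subseteq> U1"
    proof
      fix z assume "z \<in> F k ` path_image h"
      then obtain y where y: "y \<in> path_image h" "z = F k y" by blast
      then have "F n y \<in> U0" using lift_path_image[OF h(1) \<alpha>(2)] by blast
      then have "F (Suc k) y \<in> U0" by (rule F_preimage_antimono) (use that in simp)
      then show "z \<in> U1" using y by simp
    qed
  qed auto
  then have "itin n (pathfinish h) = itin n (pathstart h)" by (simp add: itin_def)
  then show ?thesis using monodromy_eq[OF h(1) \<alpha>(1) \<alpha>'] h(2) by simp
qed

section \<open>Lifting the loops around the critical values\<close>

text \<open>Injectivity of \<Lambda> forces the parameter hidden in \<open>loop_class\<close> to be
  s. The filter is kept so that t can be chosen to meet further smallness conditions.\<close>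

lemma loop_class_eventually:
  assumes "\<alpha> \<in> loop_class \<Lambda> b j"
  shows "\<forall>\<^sub>F t in at j within {0..1}. homotopic_paths (- {0, 1}) \<alpha> (lasso \<Lambda> (of_real j) s t)"
proof -
  obtain s' where s': "s' \<in> {0..1}" "\<Lambda> s' = b"
    "\<forall>\<^sub>F t in at j within {0..1}. homotopic_paths (- {0, 1}) \<alpha> (lasso \<Lambda> (of_real j) s' t)"
    using assms by (auto simp: loop_class_def)
  have "s' = s" using inj_onD[OF inj_\<Lambda> s'(2)] s' s by auto
  with s' show ?thesis by simp
qed

lemma tendsto_\<Lambda>: "j \<in> {0, 1} \<Longrightarrow> (\<Lambda> \<longlongrightarrow> of_real j) (at j within {0..1})"
  using cont_\<Lambda> \<Lambda>_0 \<Lambda>_1 unfolding continuous_on_def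
  by (metis atLeastAtMost_iff insertE order_refl singletonD zero_le_one of_real_0 of_real_1)

lemma loop_class_path:
  assumes "\<alpha> \<in> loop_class \<Lambda> b j" "j \<in> {0, 1}"
  shows "path \<alpha>" "path_image \<alpha> \<subseteq> - {0, 1}" "pathstart \<alpha> = b" "pathfinish \<alpha> = b"
proof -
  obtain t where t: "homotopic_paths (- {0, 1}) \<alpha> (lasso \<Lambda> (of_real j) s t)"
    using eventually_at_endpoint_obtain[OF assms(2) loop_class_eventually[OF assms(1)]] by blast
  show "path \<alpha>" "path_image \<alpha> \<subseteq> - {0, 1}"
    using homotopic_paths_imp_path[OF t] homotopic_paths_imp_subset[OF t] by auto
  show "pathstart \<alpha> = b" "pathfinish \<alpha> = b"
    using homotopic_paths_imp_pathstart[OF t] homotopic_paths_imp_pathfinish[OF t] by (auto simp: lasso_eq)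
qed

lemma edge_lift_inner:
  assumes "is_lift (poly f) \<Lambda> g" "r \<in> {0<..<1}"
  shows "g r \<in> U1"
proof -
  have "r \<in> {0..1}" using assms(2) by auto
  then have "poly f (g r) = \<Lambda> r" using assms(1) unfolding is_lift_def by blast
  then show ?thesis using \<Lambda>_U0[OF assms(2)] by simp
qed

text \<open>The given loop may wander anywhere outside {0, 1}, so only some homotopic \<beta> can be
  asked to lift into \<open>U0\<close>. The lift h may end at a point other than y.\<close>

definition homotopic_lift_in_U0 :: "(real \<Rightarrow> complex) \<Rightarrow> complex \<Rightarrow> bool" where
  "homotopic_lift_in_U0 \<alpha> y \<longleftrightarrow> (\<exists>\<beta> h. homotopic_paths (- {0, 1}) \<alpha> \<beta> \<and> is_lift (poly f) \<beta> h \<and>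
     pathstart h = y \<and> path_image h \<subseteq> U0)"

lemma itin_monodromy_homotopic_lift_in_U0:
  assumes "homotopic_lift_in_U0 \<alpha> (F n x)" and \<alpha>: "pathstart \<alpha> = b" and x: "F (Suc n) x = b"
  shows "itin n (monodromy (F (Suc n)) \<alpha> x) = itin n x"
proof -
  obtain \<beta> h where \<beta>: "homotopic_paths (- {0, 1}) \<alpha> \<beta>" and h: "is_lift (poly f) \<beta> h" "pathstart h = F n x" "path_image h \<subseteq> U0"
    using assms(1) by (auto simp: homotopic_lift_in_U0_def)
  have "path h" using h(1) by (simp add: is_lift_def)
  have "monodromy (F (Suc n)) \<alpha> x = monodromy (F (Suc n)) \<beta> x"
    using monodromy_homotopic[OF \<beta>, of "Suc n" x] x \<alpha> by simp
  also have "\<dots> = monodromy (F n) h x"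
    using monodromy_Suc[OF h(1) h(2)[symmetric]] homotopic_paths_imp_path[OF \<beta>] homotopic_paths_imp_subset[OF \<beta>] by simp
  finally show ?thesis
    using itin_monodromy_in_U0[OF \<open>path h\<close> h(3)] h(2) by simp
qed

text \<open>The circle around 1 fits into a disc off \<gamma>0, and the legs lie in
  \<open>U0\<close>, so the whole lasso misses \<gamma>0. It does cross \<gamma>1, but
  \<open>U0_if_maps_off_ray0\<close> still places the lift in \<open>U0\<close>.\<close>

lemma homotopic_lift_in_U0_white:
  assumes \<alpha>: "\<alpha> \<in> loop_class \<Lambda> b 1" and y: "poly f y = b"
  shows "homotopic_lift_in_U0 \<alpha> y"
proof -
  obtain r where r: "r > 0" "ball 1 r \<subseteq> - \<gamma>0"
    using closed_rays(1) mem_rays(4) open_contains_ball[of "- \<gamma>0"] by auto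
  have "\<forall>\<^sub>F t in at 1 within {0..1}. dist (\<Lambda> t) 1 < r"
    using tendsto_\<Lambda>[of 1] r(1) by (auto dest: tendstoD)
  from eventually_conj[OF loop_class_eventually[OF \<alpha>] this]
  obtain t where hom: "homotopic_paths (- {0, 1}) \<alpha> (lasso \<Lambda> 1 s t)" and t: "t \<in> {0<..<1}" "dist (\<Lambda> t) 1 < r"
    by (rule eventually_at_endpoint_obtain[rotated]) auto
  have path: "path (lasso \<Lambda> 1 s t)" "path_image (lasso \<Lambda> 1 s t) \<subseteq> - {0, 1}"
    using homotopic_paths_imp_path[OF hom] homotopic_paths_imp_subset[OF hom] by auto
  have "path_image (subpath s t \<Lambda>) \<subseteq> - \<gamma>0" "path_image (subpath t s \<Lambda>) \<subseteq> - \<gamma>0"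
    using path_image_subpath_inner[OF s t(1), of \<Lambda>] path_image_subpath_inner[OF t(1) s, of \<Lambda>] \<Lambda>_U0 by blast+
  moreover have "path_image (circle_from 1 (\<Lambda> t)) \<subseteq> - \<gamma>0"
  proof -
    have "sphere 1 (dist 1 (\<Lambda> t)) \<subseteq> ball 1 r" using t(2) by (auto simp: dist_commute)
    then show ?thesis using circle_from(5)[of 1 "\<Lambda> t"] r(2) by blast
  qed
  ultimately have off: "path_image (lasso \<Lambda> 1 s t) \<subseteq> - \<gamma>0"
    unfolding lasso_eq by (intro path_image_join3_subset)
  have "F 1 y = pathstart (lasso \<Lambda> 1 s t)" using y by (simp add: lasso_eq)
  then obtain h where h: "is_lift (F 1) (lasso \<Lambda> 1 s t) h" "pathstart h = y"
    by (rule lift_exists[OF path])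
  have "path_image h \<subseteq> U0"
    using lift_path_image[OF h(1) off] U0_if_maps_off_ray0 by auto
  then show ?thesis
    using hom h unfolding homotopic_lift_in_U0_def by (auto simp: o_def id_def)
qed

lemma circle_lift:
  assumes "t \<in> {0<..<1}" and g: "is_lift (poly f) \<Lambda> g" and avoid: "path_image (circle_from 0 (\<Lambda> t)) \<subseteq> - {0, 1}"
  obtains c where "is_lift (poly f) (circle_from 0 (\<Lambda> t)) c" "pathstart c = g t"
proof -
  have "F 1 (g t) = pathstart (circle_from 0 (\<Lambda> t))"
    using g assms(1) by (simp add: is_lift_def circle_from)
  then obtain c where "is_lift (F 1) (circle_from 0 (\<Lambda> t)) c" "pathstart c = g t"
    using lift_exists[OF circle_from(1) avoid] by metis
  then show ?thesis using that by simp
qed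

lemma path_image_circle_lift_near:
  assumes g: "is_lift (poly f) \<Lambda> g" and "\<delta> > 0"
  shows "\<forall>\<^sub>F t in at 0 within {0..1}. \<forall>c. is_lift (poly f) (circle_from 0 (\<Lambda> t)) c \<and> pathstart c = g t \<longrightarrow> path_image c \<subseteq> ball (g 0) \<delta>"
proof -
  have "continuous_on {0..1} g" using g by (simp add: is_lift_def path_def)
  from poly_circle_lift_near[OF deg_pos this \<open>\<delta> > 0\<close>] eventually_at_endpoint[of 0]
  have "\<forall>\<^sub>F t in at 0 within {0..1}. t \<in> {0<..<1} \<and> (\<forall>c. path c \<and> pathstart c = g t \<and>
     (\<forall>u\<in>{0..1}. dist (poly f (g 0)) (poly f (c u)) \<le> dist (poly f (g 0)) (poly f (g t))) \<longrightarrow> path_image c \<subseteq> ball (g 0) \<delta>)"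
    by (simp add: eventually_conj_iff)
  then show ?thesis
  proof eventually_elim
    case (elim t)
    have "poly f (g 0) = 0" "poly f (g t) = \<Lambda> t" using g elim by (auto simp: is_lift_def \<Lambda>_0)
    moreover have "path c" "\<forall>u\<in>{0..1}. dist 0 (poly f (c u)) \<le> dist 0 (\<Lambda> t)"
      if "is_lift (poly f) (circle_from 0 (\<Lambda> t)) c" for c
      using that circle_from(4)[of 0 "\<Lambda> t"] by (simp_all add: is_lift_def)
    ultimately show ?case using elim by metis
  qed
qed

lemma lasso_avoids:
  assumes "homotopic_paths (- {0, 1}) \<alpha> (lasso \<Lambda> j s t)"
  shows "path_image (circle_from j (\<Lambda> t)) \<subseteq> - {0, 1}"
proof -
  have "path_image (lasso \<Lambda> j s t) \<subseteq> - {0, 1}" using homotopic_paths_imp_subset[OF assms] by simp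
  then show ?thesis
    unfolding lasso_eq by (simp add: path_image_join circle_from)
qed

text \<open>The vertex g 0 lies in the open set \<open>U0\<close>, and the lifted circle stays near
  it. That circle stops on another edge when the local degree at the vertex exceeds one, so the
  return leg gets its own lift k.\<close>

lemma homotopic_lift_in_U0_black:
  assumes \<alpha>: "\<alpha> \<in> loop_class \<Lambda> b 0" and g: "is_lift (poly f) \<Lambda> g" and v: "g 0 \<noteq> 0" "g 0 \<noteq> 1"
  shows "homotopic_lift_in_U0 \<alpha> (g s)"
proof -
  have "poly f (g 0) = 0" using g by (simp add: is_lift_def \<Lambda>_0)
  then have "g 0 \<in> U0" using v by (rule zero_preimage_mem_U0)
  then obtain \<delta> where \<delta>: "\<delta> > 0" "ball (g 0) \<delta> \<subseteq> U0"
    using open_U0 open_contains_ball[of U0] by blast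
  from eventually_conj[OF loop_class_eventually[OF \<alpha>] path_image_circle_lift_near[OF g \<delta>(1)]]
  obtain t where hom: "homotopic_paths (- {0, 1}) \<alpha> (lasso \<Lambda> 0 s t)" and t: "t \<in> {0<..<1}"
    and near: "\<And>c. is_lift (poly f) (circle_from 0 (\<Lambda> t)) c \<Longrightarrow> pathstart c = g t \<Longrightarrow> path_image c \<subseteq> ball (g 0) \<delta>"
    by (rule eventually_at_endpoint_obtain[rotated]) auto
  obtain c where c: "is_lift (poly f) (circle_from 0 (\<Lambda> t)) c" "pathstart c = g t"
    using circle_lift[OF t g lasso_avoids[OF hom]] .
  have cU: "path_image c \<subseteq> U0" using near[OF c] \<delta>(2) by blast
  have ts: "path (subpath t s \<Lambda>)" "path_image (subpath t s \<Lambda>) \<subseteq> U0"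
    using path_\<Lambda> s t path_image_subpath_inner[OF t s, of \<Lambda>] \<Lambda>_U0 by (auto intro!: path_subpath)
  have "poly f (pathfinish c) = \<Lambda> t"
    using c(1) circle_from(3)[of 0 "\<Lambda> t"] by (simp add: is_lift_def pathfinish_def)
  then have "F 1 (pathfinish c) = pathstart (subpath t s \<Lambda>)" by simp
  then obtain k where k: "is_lift (F 1) (subpath t s \<Lambda>) k" "pathstart k = pathfinish c"
    using lift_exists[OF ts(1)] ts(2) U0_01 by (metis order_trans)
  have kU: "path_image k \<subseteq> U0"
  proof -
    have "path_image k \<subseteq> U1" using lift_path_image[OF k(1) ts(2)] by simp
    then show ?thesis using U1_subset_U0 by (rule order_trans)
  qed
  have gst: "is_lift (poly f) (subpath s t \<Lambda>) (subpath s t g)"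
    by (rule is_lift_subpath[OF g]) (use s t in auto)
  have gU: "path_image (subpath s t g) \<subseteq> U0"
    using path_image_subpath_inner[OF s t, of g] edge_lift_inner[OF g] U1_subset_U0 by blast
  have "is_lift (poly f) (lasso \<Lambda> 0 s t) (subpath s t g +++ c +++ k)"
    unfolding lasso_eq by (intro is_lift_join gst c(1)) (use k c(2) in auto)
  moreover have "path_image (subpath s t g +++ c +++ k) \<subseteq> U0"
    using gU cU kU by (rule path_image_join3_subset)
  ultimately show ?thesis
    using hom unfolding homotopic_lift_in_U0_def
    by (intro exI[of _ "lasso \<Lambda> 0 s t"] exI[of _ "subpath s t g +++ c +++ k"] conjI) simp_all
qed

text \<open>Since \<open>f\<close> is biholomorphic near \<open>v = g 0\<close>, a small loop around \<open>0\<close> lifts to a loop around \<open>v\<close>. The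
  lift and the standard loop around \<open>v\<close> are freely homotopic off the ray at \<open>1 - v\<close>.\<close>

lemma loop_lifts_to_loop:
  assumes j: "j \<in> {0, 1}" and \<alpha>: "\<alpha> \<in> loop_class \<Lambda> b 0" and \<alpha>': "\<alpha>' \<in> loop_class \<Lambda> b j"
    and g: "is_lift (poly f) \<Lambda> g" and v: "g 0 = of_real j"
  obtains \<beta> h \<tau> where "homotopic_paths (- {0, 1}) \<alpha> \<beta>" "is_lift (poly f) \<beta> h" "pathstart h = g s" "pathfinish h = g s"
    "path \<tau>" "path_image \<tau> \<subseteq> U0" "pathstart \<tau> = g s" "pathfinish \<tau> = b"
    "homotopic_paths (- {0, 1}) h (\<tau> +++ \<alpha>' +++ reversepath \<tau>)"
proof -
  define v where "v = g 0"
  have vj: "v = of_real j" "v \<in> {0, 1}" using v j by (auto simp: v_def)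
  have fv: "poly f v = 0" using g by (simp add: v_def is_lift_def \<Lambda>_0)
  \<comment> \<open>The ray landing at v stays in \<open>W\<close> and the other one is removed;
    hence v lies in \<open>W\<close>, and \<open>U0\<close> inside \<open>W - {v}\<close>.\<close>
  define W where "W = - (if j = 0 then \<gamma>1 else \<gamma>0)"
  have W: "open W" "simply_connected W" "v \<in> W" "W - {v} \<subseteq> - {0, 1}" "U0 \<subseteq> W - {v}"
    using j vj closed_rays simply_connected_off_ray mem_rays by (auto simp: W_def split: if_splits)
  obtain \<delta>0 where \<delta>0: "\<delta>0 > 0" "inj_on (poly f) (ball v \<delta>0)"
    "\<And>z. z \<in> ball v \<delta>0 \<Longrightarrow> norm ((poly f z - poly f v) / poly (pderiv f) v - (z - v)) \<le> norm (z - v) / 2"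
    using poly_linear_approx_near[OF pderiv_f[OF vj(2)]] by metis
  obtain \<delta>1 where \<delta>1: "\<delta>1 > 0" "ball v \<delta>1 \<subseteq> W"
    using W(1,3) open_contains_ball[of W] by blast
  \<comment> \<open>Halving \<delta>1 leaves room in \<open>W\<close> for the ball of radius 2
    \<delta> in which the circles are compared.\<close>
  define \<delta> where "\<delta> = min \<delta>0 (\<delta>1 / 2)"
  have \<delta>: "\<delta> > 0" "ball v \<delta> \<subseteq> ball v \<delta>0" "ball v (2 * \<delta>) \<subseteq> W"
    using \<delta>0(1) \<delta>1 by (auto simp: \<delta>_def)
  have inj: "inj_on (poly f) (ball v \<delta>)" using \<delta>0(2) \<delta>(2) by (rule inj_on_subset)

  from eventually_conj[OF loop_class_eventually[OF \<alpha>] path_image_circle_lift_near[OF g \<delta>(1)]]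
  obtain t where hom: "homotopic_paths (- {0, 1}) \<alpha> (lasso \<Lambda> 0 s t)" and t: "t \<in> {0<..<1}"
    and near: "\<And>c. is_lift (poly f) (circle_from 0 (\<Lambda> t)) c \<Longrightarrow> pathstart c = g t \<Longrightarrow> path_image c \<subseteq> ball v \<delta>"
    unfolding v_def by (rule eventually_at_endpoint_obtain[rotated]) auto
  obtain c where c: "is_lift (poly f) (circle_from 0 (\<Lambda> t)) c" "pathstart c = g t"
    using circle_lift[OF t g lasso_avoids[OF hom]] .
  have cB: "path_image c \<subseteq> ball v \<delta>" by (rule near[OF c])
  have fc: "poly f (c u) = \<Lambda> t * exp (2 * of_real pi * \<i> * of_real u)" if "u \<in> {0..1}" for u
    using c(1) that by (simp add: is_lift_def circle_from_def)
  have "\<Lambda> t \<noteq> 0" using \<Lambda>_U0[OF t] U0_01 by auto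
  have pc: "path c" using c(1) by (simp add: is_lift_def)
  \<comment> \<open>Injectivity of f near v closes the lifted circle; here the local degree one at 0
    and 1 enters.\<close>
  have closed: "pathfinish c = pathstart c"
  proof (rule inj_onD[OF inj])
    show "poly f (pathfinish c) = poly f (pathstart c)"
      using fc[of 0] fc[of 1] by (simp add: pathstart_def pathfinish_def)
  qed (use cB in auto)
  have cv: "path_image c \<subseteq> ball v \<delta> - {v}"
  proof -
    have "c u \<noteq> v" if "u \<in> {0..1}" for u
      using fc[OF that] fv \<open>\<Lambda> t \<noteq> 0\<close> by auto
    then have "v \<notin> path_image c" unfolding path_image_def by blast
    then show ?thesis using cB by blast
  qed

  \<comment> \<open>The loop around j has its own circle, with parameter t' near j, whereas t is
    near 0 for the loop that is lifted.\<close>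
  have "\<forall>\<^sub>F t in at j within {0..1}. dist (\<Lambda> t) v < 2 * \<delta>"
    using tendsto_\<Lambda>[OF j] \<delta>(1) unfolding vj(1) by (intro tendstoD) auto
  from eventually_conj[OF loop_class_eventually[OF \<alpha>'] this]
  obtain t' where hom': "homotopic_paths (- {0, 1}) \<alpha>' (lasso \<Lambda> v s t')" and t': "t' \<in> {0<..<1}" "dist (\<Lambda> t') v < 2 * \<delta>"
    unfolding vj(1) by (rule eventually_at_endpoint_obtain[OF j]) auto
  have "\<Lambda> t' \<noteq> v" using \<Lambda>_U0[OF t'(1)] W(5) by blast

  \<comment> \<open>By linear approximation c - v is close to the circle with factor \<Lambda> t /
    f'(v), so c turns once counterclockwise around v.\<close>
  have circ: "homotopic_loops (ball v (2 * \<delta>) - {v}) c (circle_from v (\<Lambda> t'))"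
    unfolding circle_from_def[abs_def]
  proof (rule homotopic_loops_circle_near[OF pc closed cv])
    fix u :: real assume u: "u \<in> {0..1}"
    have "c u \<in> path_image c" using u by (simp add: path_image_def)
    then have "c u \<in> ball v \<delta>0" using cB \<delta>(2) by blast
    from \<delta>0(3)[OF this] show "norm (\<Lambda> t / poly (pderiv f) v * exp (2 * of_real pi * \<i> * of_real u) - (c u - v)) \<le> norm (c u - v) / 2"
      using fc[OF u] fv by simp
  qed (use \<open>\<Lambda> t' \<noteq> v\<close> t'(2) in \<open>auto simp: dist_norm\<close>)
  then have circ: "homotopic_loops (W - {v}) c (circle_from v (\<Lambda> t'))"
    by (rule homotopic_loops_subset) (use \<delta>(3) in blast)

  define h where "h = subpath s t g +++ c +++ subpath t s g"
  have h_lift: "is_lift (poly f) (lasso \<Lambda> 0 s t) h"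
    unfolding lasso_eq h_def
    by (intro is_lift_join is_lift_subpath g c(1)) (use s t c(2) closed in auto)
  have g_inner: "g ` {0<..<1} \<subseteq> U0" using edge_lift_inner[OF g] U1_subset_U0 by blast
  \<comment> \<open>The legs of h run out and back along the same edge, so h is conjugate to its
    middle part c.\<close>
  have h_conj: "homotopic_loops (W - {v}) h c"
  proof -
    have "path (subpath s t g)" using g s t by (intro path_subpath) (auto simp: is_lift_def)
    moreover have "path_image (subpath s t g) \<subseteq> W - {v}"
      using path_image_subpath_inner[OF s t, of g] g_inner W(5) by blast
    moreover have "path_image c \<subseteq> W - {v}" using homotopic_loops_imp_subset[OF circ] by blast
    ultimately have "homotopic_loops (W - {v}) (subpath s t g +++ c +++ reversepath (subpath s t g)) c"
      using pc closed c(2) by (intro homotopic_loops_conjugate) auto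
    then show ?thesis by (simp add: h_def reversepath_subpath)
  qed
  have lasso_conj: "homotopic_loops (W - {v}) (lasso \<Lambda> v s t') (circle_from v (\<Lambda> t'))"
  proof -
    have "path (subpath s t' \<Lambda>)" using path_\<Lambda> s t'(1) by (intro path_subpath) auto
    moreover have "path_image (subpath s t' \<Lambda>) \<subseteq> W - {v}"
      using path_image_subpath_inner[OF s t'(1), of \<Lambda>] \<Lambda>_U0 W(5) by blast
    moreover have "path_image (circle_from v (\<Lambda> t')) \<subseteq> W - {v}" using homotopic_loops_imp_subset[OF circ] by blast
    ultimately have "homotopic_loops (W - {v}) (subpath s t' \<Lambda> +++ circle_from v (\<Lambda> t') +++ reversepath (subpath s t' \<Lambda>)) (circle_from v (\<Lambda> t'))"
      by (intro homotopic_loops_conjugate) (auto simp: circle_from)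
    then show ?thesis by (simp add: lasso_eq reversepath_subpath)
  qed

  have "path_connected U0" using simply_connected_U0 by (rule simply_connected_imp_path_connected)
  moreover have "g s \<in> U0" using g_inner s by blast
  ultimately obtain \<tau> where \<tau>: "path \<tau>" "path_image \<tau> \<subseteq> U0" "pathstart \<tau> = g s" "pathfinish \<tau> = b"
    using \<Lambda>_U0[OF s] unfolding path_connected_def by blast
  have \<tau>W: "path_image \<tau> \<subseteq> W - {v}" using \<tau>(2) W(5) by blast
  have L: "path (lasso \<Lambda> v s t')" "path_image (lasso \<Lambda> v s t') \<subseteq> W - {v}" "pathstart (lasso \<Lambda> v s t') = b" "pathfinish (lasso \<Lambda> v s t') = b"
    using homotopic_loops_imp_path[OF lasso_conj] homotopic_loops_imp_subset[OF lasso_conj] by (auto simp: lasso_eq)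
  have "homotopic_loops (W - {v}) (\<tau> +++ lasso \<Lambda> v s t' +++ reversepath \<tau>) (lasso \<Lambda> v s t')"
    using \<tau> \<tau>W L by (intro homotopic_loops_conjugate) auto
  then have "homotopic_loops (W - {v}) h (\<tau> +++ lasso \<Lambda> v s t' +++ reversepath \<tau>)"
    using h_conj circ lasso_conj by (meson homotopic_loops_trans homotopic_loops_sym)
  \<comment> \<open>Both loops start at g s, so the free homotopy in the punctured domain upgrades
    to one with fixed ends.\<close>
  then have "homotopic_paths (W - {v}) h (\<tau> +++ lasso \<Lambda> v s t' +++ reversepath \<tau>)"
    by (rule homotopic_loops_imp_homotopic_paths_punctured[OF W(1-3)]) (simp add: h_def \<tau>)
  then have "homotopic_paths (- {0, 1}) h (\<tau> +++ lasso \<Lambda> v s t' +++ reversepath \<tau>)"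
    using W(4) by (rule homotopic_paths_subset)
  moreover have "homotopic_paths (- {0, 1}) (\<tau> +++ lasso \<Lambda> v s t' +++ reversepath \<tau>) (\<tau> +++ \<alpha>' +++ reversepath \<tau>)"
  proof -
    have "path_image \<tau> \<subseteq> - {0, 1}" using \<tau>W W(4) by blast
    then show ?thesis
      using \<tau> L hom' by (intro homotopic_paths_join) (auto simp: homotopic_paths_sym)
  qed
  ultimately have "homotopic_paths (- {0, 1}) h (\<tau> +++ \<alpha>' +++ reversepath \<tau>)"
    by (rule homotopic_paths_trans)
  moreover have "pathstart h = g s" "pathfinish h = g s" by (simp_all add: h_def)
  ultimately show ?thesis using that[OF hom h_lift _ _ \<tau>] by simp
qed

text \<open>The path \<tau> carries the fibre over g s to the fibre over b, where the permutation of
  \<alpha>' is defined, without changing itineraries; its reverse leads back. The last entry stays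
  because the result lies over g s = F n x again.\<close>

lemma itin_monodromy_loop:
  assumes j: "j \<in> {0, 1}" and \<alpha>: "\<alpha> \<in> loop_class \<Lambda> b 0" and \<alpha>': "\<alpha>' \<in> loop_class \<Lambda> b j"
    and g: "is_lift (poly f) \<Lambda> g" and v: "g 0 = of_real j" and x: "F (Suc n) x = b" "F n x = g s"
  shows "itin (Suc n) (monodromy (F (Suc n)) \<alpha> x) =
    itinerary_monodromy f \<gamma>0 \<gamma>1 \<Lambda> b \<alpha>' n (itin n x) @ [label (F n x)]"
proof -
  obtain \<beta> h \<tau> where \<beta>: "homotopic_paths (- {0, 1}) \<alpha> \<beta>" "is_lift (poly f) \<beta> h" "pathstart h = g s" "pathfinish h = g s"
    and \<tau>: "path \<tau>" "path_image \<tau> \<subseteq> U0" "pathstart \<tau> = g s" "pathfinish \<tau> = b"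
    and h: "homotopic_paths (- {0, 1}) h (\<tau> +++ \<alpha>' +++ reversepath \<tau>)"
    using loop_lifts_to_loop[OF j \<alpha> \<alpha>' g v] .
  note A = loop_class_path[OF \<alpha>' j]
  have \<alpha>b: "pathstart \<alpha> = b" using loop_class_path[OF \<alpha>] by simp
  have \<beta>p: "path \<beta>" "path_image \<beta> \<subseteq> - {0, 1}"
    using homotopic_paths_imp_path[OF \<beta>(1)] homotopic_paths_imp_subset[OF \<beta>(1)] by auto
  have hp: "path h" "path_image h \<subseteq> - {0, 1}"
    using homotopic_paths_imp_path[OF h] homotopic_paths_imp_subset[OF h] by auto
  have \<tau>': "path_image \<tau> \<subseteq> - {0, 1}" using \<tau>(2) U0_01 by blast
  define x1 where "x1 = monodromy (F n) \<tau> x"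
  have x1: "F n x1 = b" "itin n x1 = itin n x"
    using F_monodromy[OF \<tau>(1) \<tau>', of n x] itin_monodromy_in_U0[OF \<tau>(1,2), of n x] \<tau> x(2) by (auto simp: x1_def)
  define x2 where "x2 = monodromy (F n) \<alpha>' x1"
  have x2: "F n x2 = b" using F_monodromy[OF A(1,2), of n x1] A x1 by (simp add: x2_def)
  have "monodromy (F (Suc n)) \<alpha> x = monodromy (F n) h x"
    using monodromy_homotopic[OF \<beta>(1), of "Suc n" x] monodromy_Suc[OF \<beta>(2) _ \<beta>p, of n x] x \<alpha>b \<beta>(3) by simp
  also have "\<dots> = monodromy (F n) (\<tau> +++ \<alpha>' +++ reversepath \<tau>) x"
    using monodromy_homotopic[OF h, of n x] \<beta>(3) x(2) by simp
  also have "\<dots> = monodromy (F n) (\<alpha>' +++ reversepath \<tau>) x1"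
    unfolding x1_def using \<tau> \<tau>' A x(2) by (intro monodromy_join) (auto simp: path_image_join)
  also have "\<dots> = monodromy (F n) (reversepath \<tau>) x2"
    unfolding x2_def using \<tau> \<tau>' A x1(1) by (intro monodromy_join) auto
  finally have m: "monodromy (F (Suc n)) \<alpha> x = monodromy (F n) (reversepath \<tau>) x2" .
  have "itin n (monodromy (F (Suc n)) \<alpha> x) = itin n x2"
    unfolding m using itin_monodromy_in_U0[of "reversepath \<tau>" n x2] \<tau> x2 by simp
  also have "\<dots> = itinerary_monodromy f \<gamma>0 \<gamma>1 \<Lambda> b \<alpha>' n (itin n x)"
    using itinerary_monodromy_itin[OF A x1(1)] x1(2) by (simp add: x2_def)
  finally have "itin n (monodromy (F (Suc n)) \<alpha> x) = itinerary_monodromy f \<gamma>0 \<gamma>1 \<Lambda> b \<alpha>' n (itin n x)" .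
  moreover have "F n (monodromy (F (Suc n)) \<alpha> x) = F n x"
    unfolding m using F_monodromy[of "reversepath \<tau>" n x2] \<tau> \<tau>' x2 x(2) by simp
  ultimately show ?thesis by (simp add: itin_Suc)
qed

text \<open>The lift in \<open>U0\<close> fixes the first n entries. The last one is read off from
  where \<alpha> moves F n x under f, that is, from the permutation of the edges of the dessin of
  f.\<close>

lemma itin_monodromy_last:
  assumes \<alpha>: "path \<alpha>" "path_image \<alpha> \<subseteq> - {0, 1}" "pathstart \<alpha> = b" "pathfinish \<alpha> = b"
    and lift: "homotopic_lift_in_U0 \<alpha> (F n x)" and x: "F (Suc n) x = b"
  shows "itin (Suc n) (monodromy (F (Suc n)) \<alpha> x) = itin n x @ [edge_monodromy f \<Lambda> b \<alpha> 1 (label (F n x))]"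
proof -
  have "F n (monodromy (F (Suc n)) \<alpha> x) = monodromy (poly f) \<alpha> (F n x)"
    using F_monodromy_Suc[OF \<alpha>(1,2)] x \<alpha>(3) by simp
  moreover have fx: "poly f (F n x) = b" using x by simp
  moreover have "edge_monodromy f \<Lambda> b \<alpha> 1 (edge 1 (F n x)) = edge 1 (monodromy (poly f) \<alpha> (F n x))"
    using edge_monodromy_edge[OF \<alpha>, of 1 "F n x"] fx by simp
  moreover have "poly f (monodromy (poly f) \<alpha> (F n x)) = b"
    using F_monodromy[OF \<alpha>(1,2), of 1 "F n x"] \<alpha>(3,4) fx by simp
  ultimately show ?thesis
    using itin_monodromy_homotopic_lift_in_U0[OF lift \<alpha>(3) x] by (simp add: itin_Suc label_fibre)
qed

text \<open>Existence takes the edge through a point near v that lies over a point of \<Lambda> near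
  0: its initial piece cannot leave a small ball and must begin at v, the only zero of f there.
  Uniqueness holds because two edges at v are both close to v at small parameters, where f is
  injective.\<close>

lemma incident_edge:
  assumes v: "v \<in> {0, 1}"
  obtains g where "is_lift (poly f) \<Lambda> g" "g 0 = v" "incident_edge f \<Lambda> v = edge 1 (g s)"
    "\<And>e. e \<in> E \<Longrightarrow> v \<in> e \<Longrightarrow> e = edge 1 (g s)"
proof -
  have fv: "poly f v = 0" using v f_0 f_1 by auto
  obtain \<delta> where \<delta>: "\<delta> > 0" "inj_on (poly f) (ball v \<delta>)"
    using poly_linear_approx_near[OF pderiv_f[OF v]] by metis
  obtain \<eta> where \<eta>: "\<eta> > 0"
    "\<And>A z v. connected A \<Longrightarrow> poly f ` A \<subseteq> ball 0 \<eta> \<Longrightarrow> z \<in> A \<Longrightarrow> poly f v = 0 \<Longrightarrow>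
       (\<And>v'. poly f v' = 0 \<Longrightarrow> v' \<noteq> v \<Longrightarrow> 2 * (\<delta> / 2) \<le> dist v v') \<Longrightarrow> z \<in> ball v (\<delta> / 2) \<Longrightarrow> A \<subseteq> ball v (\<delta> / 2)"
    using poly_connected_near_preimage[OF deg_pos, of "\<delta> / 2" 0] \<delta>(1) by (metis half_gt_zero)
  have sep: "2 * (\<delta> / 2) \<le> dist v v'" if "poly f v' = 0" "v' \<noteq> v" for v'
    using inj_onD[OF \<delta>(2), of v v'] that fv \<delta>(1) by (force simp: not_less)
  have "open (poly f ` ball v (\<delta> / 2))"
    by (rule invariance_of_domain) (use \<delta> in \<open>auto intro!: continuous_intros intro: inj_on_subset\<close>)
  moreover have "0 \<in> poly f ` ball v (\<delta> / 2)"
    using fv \<delta>(1) by (intro image_eqI[of _ _ v]) auto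
  ultimately obtain \<mu> where \<mu>: "\<mu> > 0" "ball 0 \<mu> \<subseteq> poly f ` ball v (\<delta> / 2)"
    unfolding open_contains_ball by blast
  have "continuous (at 0 within {0..1}) \<Lambda>"
    using cont_\<Lambda> by (simp add: continuous_on_eq_continuous_within)
  then obtain d where d: "d > 0" "\<And>r. r \<in> {0..1} \<Longrightarrow> dist r 0 < d \<Longrightarrow> dist (\<Lambda> r) 0 < min \<mu> \<eta>"
    unfolding continuous_within_eps_delta using \<mu>(1) \<eta>(1) \<Lambda>_0 by (metis min_less_iff_conj)
  define t where "t = min (1/2) (d / 2)"
  have t: "t \<in> {0<..<1}" "t < d" using d(1) by (auto simp: t_def)
  have "\<Lambda> t \<in> ball 0 \<mu>" using d(2)[of t] t by (auto simp: dist_commute)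
  then obtain z where z: "z \<in> ball v (\<delta> / 2)" "poly f z = \<Lambda> t" using \<mu>(2) by (metis imageE subsetD)
  obtain g where "is_lift (F 1) \<Lambda> g" "g t = z"
    using edge_lift_exists[OF _ t(1), of 1 z] z(2) by auto
  then have g: "is_lift (poly f) \<Lambda> g" "g t = z" by auto
  have contg: "continuous_on {0..1} g" using g(1) by (simp add: is_lift_def path_def)
  have "g ` {0..t} \<subseteq> ball v (\<delta> / 2)"
  proof (rule \<eta>(2)[OF _ _ _ fv sep])
    show "connected (g ` {0..t})"
      using contg t by (intro connected_continuous_image) (auto intro: continuous_on_subset)
    show "poly f ` g ` {0..t} \<subseteq> ball 0 \<eta>"
    proof clarify
      fix r assume "r \<in> {0..t}"
      then have "r \<in> {0..1}" "dist r 0 < d" using t by auto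
      then show "poly f (g r) \<in> ball 0 \<eta>" using d(2)[of r] g(1) by (simp add: is_lift_def)
    qed
    show "z \<in> g ` {0..t}" using g(2) t by auto
  qed (use z in auto)
  moreover have "0 \<in> {0..t}" using t by auto
  ultimately have "g 0 \<in> ball v (\<delta> / 2)" by blast
  moreover have fg0: "poly f (g 0) = 0" using g(1) by (simp add: is_lift_def \<Lambda>_0)
  ultimately have g0: "g 0 = v"
    using inj_onD[OF \<delta>(2), of "g 0" v] fv \<delta>(1) by auto
  have uniq: "e = edge 1 (g s)" if e: "e \<in> E" "v \<in> e" for e
  proof -
    obtain k where k: "is_lift (poly f) \<Lambda> k" "e = path_image k" using e(1) by (auto simp: dessin_edges_def)
    obtain r where r: "r \<in> {0..1}" "k r = v" using e(2) k(2) by (auto simp: path_image_def)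
    \<comment> \<open>As f v = 0, an edge reaches v over the black end of \<Lambda>, hence at
      parameter 0.\<close>
    have "\<Lambda> r = \<Lambda> 0" using k(1) r fv by (auto simp: is_lift_def \<Lambda>_0)
    then have "r = 0" using inj_onD[OF inj_\<Lambda>, of r 0] r(1) by simp
    then have k0: "k 0 = v" using r by simp
    have contk: "continuous_on {0..1} k" using k(1) by (simp add: is_lift_def path_def)
    have "(g \<longlongrightarrow> g 0) (at 0 within {0..1})" "(k \<longlongrightarrow> k 0) (at 0 within {0..1})"
      using contg contk by (auto simp: continuous_on_def)
    then have "\<forall>\<^sub>F u in at 0 within {0..1}. dist (g u) v < \<delta>" "\<forall>\<^sub>F u in at 0 within {0..1}. dist (k u) v < \<delta>"
      using \<delta>(1) unfolding g0 k0 by (auto intro: tendstoD)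
    from eventually_conj[OF this]
    obtain u where u: "u \<in> {0<..<1}" "dist (g u) v < \<delta>" "dist (k u) v < \<delta>"
      by (rule eventually_at_endpoint_obtain[rotated]) auto
    have "poly f (k u) = poly f (g u)" using u(1) g(1) k(1) by (auto simp: is_lift_def)
    then have "k u = g u" using inj_onD[OF \<delta>(2), of "k u" "g u"] u by (simp add: dist_commute)
    then have "k s = g s" using edge_lift_unique[of 1 k g u s] g(1) k(1) u(1) s by auto
    then show "e = edge 1 (g s)" using edge_eq[of 1 k] k by simp
  qed
  have "edge 1 (g s) = path_image g" using edge_eq[of 1 g] g(1) by simp
  then have "edge 1 (g s) \<in> E" "v \<in> edge 1 (g s)"
    using g(1) g0 by (auto simp: dessin_edges_def path_image_def)
  then have "incident_edge f \<Lambda> v = edge 1 (g s)"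
    unfolding incident_edge_def using uniq by (intro the_equality) blast+
  then show ?thesis using that g(1) g0 uniq by blast
qed

lemma incident_edge_unique:
  assumes "v \<in> {0, 1}" "e \<in> E" "v \<in> e"
  shows "e = incident_edge f \<Lambda> v"
  using incident_edge[OF assms(1)] assms(2,3) by metis

end

theorem theorem4p2:
  fixes f :: "complex poly" and \<gamma>0 \<gamma>1 :: "complex set"
    and \<Lambda> \<alpha>0 \<alpha>1 :: "real \<Rightarrow> complex" and b :: complex
    and n :: nat and es :: "complex set list" and e :: "complex set"
  assumes "f \<in> XDBP"
    and "closed_external_ray f 0 \<gamma>0" and "closed_external_ray f 1 \<gamma>1" and "\<gamma>0 \<inter> \<gamma>1 = {}"
    and "poly f ` \<gamma>0 = \<gamma>0" and "poly f ` \<gamma>1 = \<gamma>0"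
    and "arc \<Lambda>" and "pathstart \<Lambda> = 0" and "pathfinish \<Lambda> = 1"
    and "\<Lambda> ` {0<..<1} \<subseteq> U f \<gamma>0 \<gamma>1 0"
    and "b \<in> \<rat>" and "b \<in> open_segment 0 1" and "b \<in> path_image \<Lambda>"
    and "\<alpha>0 \<in> loop_class \<Lambda> b 0" and "\<alpha>1 \<in> loop_class \<Lambda> b 1"
    and "n \<ge> 2"
    and "length es = n - 1" and "set es \<subseteq> dessin_edges f \<Lambda> 1" and "e \<in> dessin_edges f \<Lambda> 1"
  shows "itinerary_monodromy f \<gamma>0 \<gamma>1 \<Lambda> b \<alpha>1 n (es @ [e]) = es @ [edge_monodromy f \<Lambda> b \<alpha>1 1 e] \<and>
         itinerary_monodromy f \<gamma>0 \<gamma>1 \<Lambda> b \<alpha>0 n (es @ [e]) =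
           (if e = incident_edge f \<Lambda> 1 then itinerary_monodromy f \<gamma>0 \<gamma>1 \<Lambda> b \<alpha>1 (n - 1) es @ [e]
            else if e = incident_edge f \<Lambda> 0 then itinerary_monodromy f \<gamma>0 \<gamma>1 \<Lambda> b \<alpha>0 (n - 1) es @ [e]
            else es @ [edge_monodromy f \<Lambda> b \<alpha>0 1 e])"
proof -
  obtain s where sb: "s \<in> {0..1}" "\<Lambda> s = b"
    using \<open>b \<in> path_image \<Lambda>\<close> by (auto simp: path_image_def)
  have "b \<noteq> \<Lambda> 0" "b \<noteq> \<Lambda> 1"
    using \<open>b \<in> open_segment 0 1\<close> \<open>pathstart \<Lambda> = 0\<close> \<open>pathfinish \<Lambda> = 1\<close>
    by (auto simp: open_segment_def pathstart_def pathfinish_def)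
  then have "s \<noteq> 0" "s \<noteq> 1" using sb(2) by auto
  then interpret xdbp_dessin f \<gamma>0 \<gamma>1 \<Lambda> s
    using assms sb(1) by unfold_locales auto
  have b: "b = \<Lambda> s" using sb(2) by simp
  define m where "m = length es"
  have n: "n = Suc m" "n - 1 = m" using assms(16,17) by (auto simp: m_def)
  \<comment> \<open>Surjectivity of itineraries replaces the given list by a fibre point, after
    which the inverse hidden in \<open>itinerary_monodromy\<close> disappears.\<close>
  obtain x where x: "F (Suc m) x = \<Lambda> s" and it: "itin (Suc m) x = es @ [e]"
    using itin_surj[of "es @ [e]" "\<Lambda> s"] assms(18,19) \<Lambda>_U0[of s] sb(1) \<open>s \<noteq> 0\<close> \<open>s \<noteq> 1\<close>
    by (auto simp: m_def)
  have es: "itin m x = es" "label (F m x) = e"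
    using it by (auto simp: itin_Suc)
  have fx: "poly f (F m x) = \<Lambda> s" using x by simp
  have e: "e = edge 1 (F m x)" using label_fibre[OF fx] es(2) by simp
  have \<alpha>0: "\<alpha>0 \<in> loop_class \<Lambda> (\<Lambda> s) 0" and \<alpha>1: "\<alpha>1 \<in> loop_class \<Lambda> (\<Lambda> s) 1"
    using assms(14,15) by (simp_all add: b)
  have p0: "path \<alpha>0" "path_image \<alpha>0 \<subseteq> - {0, 1}" "pathstart \<alpha>0 = \<Lambda> s" "pathfinish \<alpha>0 = \<Lambda> s"
    using loop_class_path[OF \<alpha>0] by auto
  have p1: "path \<alpha>1" "path_image \<alpha>1 \<subseteq> - {0, 1}" "pathstart \<alpha>1 = \<Lambda> s" "pathfinish \<alpha>1 = \<Lambda> s"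
    using loop_class_path[OF \<alpha>1] by auto
  have it0: "itinerary_monodromy f \<gamma>0 \<gamma>1 \<Lambda> b \<alpha>0 n (es @ [e]) = itin (Suc m) (monodromy (F (Suc m)) \<alpha>0 x)"
    and it1: "itinerary_monodromy f \<gamma>0 \<gamma>1 \<Lambda> b \<alpha>1 n (es @ [e]) = itin (Suc m) (monodromy (F (Suc m)) \<alpha>1 x)"
    using itinerary_monodromy_itin[OF p0 x] itinerary_monodromy_itin[OF p1 x] unfolding it b n by auto

  have white: "itin (Suc m) (monodromy (F (Suc m)) \<alpha>1 x) = es @ [edge_monodromy f \<Lambda> b \<alpha>1 1 e]"
    using itin_monodromy_last[OF p1 homotopic_lift_in_U0_white[OF \<alpha>1 fx] x] unfolding es b .
  \<comment> \<open>One statement serves both exceptional edges: j is the vertex, and the loop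
    \<alpha>' around j acts on the first entries.\<close>
  have special: "itin (Suc m) (monodromy (F (Suc m)) \<alpha>0 x) = itinerary_monodromy f \<gamma>0 \<gamma>1 \<Lambda> b \<alpha>' m es @ [e]"
    if ej: "e = incident_edge f \<Lambda> (of_real j)" and j: "j \<in> {0, 1}" and \<alpha>': "\<alpha>' \<in> loop_class \<Lambda> (\<Lambda> s) j" for j \<alpha>'
  proof -
    have "complex_of_real j \<in> {0, 1}" using j by auto
    then obtain g where g: "is_lift (poly f) \<Lambda> g" "g 0 = of_real j" "incident_edge f \<Lambda> (of_real j) = edge 1 (g s)"
      by (rule incident_edge)
    have "poly f (g s) = \<Lambda> s" using g(1) sb(1) by (simp add: is_lift_def)
    then have "F m x = g s"
      using edge_inj[of 1 "F m x" "g s"] fx e ej g(3) by simp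
    from itin_monodromy_loop[OF j \<alpha>0 \<alpha>' g(1,2) x this] show ?thesis
      unfolding es b .
  qed
  have black: "itin (Suc m) (monodromy (F (Suc m)) \<alpha>0 x) = es @ [edge_monodromy f \<Lambda> b \<alpha>0 1 e]"
    if ne: "e \<noteq> incident_edge f \<Lambda> 1" "e \<noteq> incident_edge f \<Lambda> 0"
  proof -
    \<comment> \<open>Here g parametrizes e itself; its black end is neither 0 nor 1, since each of
      these lies only on its incident edge.\<close>
    obtain g where g: "is_lift (F 1) \<Lambda> g" "g s = F m x"
      using edge_lift_exists[of 1 "F m x" s] fx sb(1) \<open>s \<noteq> 0\<close> \<open>s \<noteq> 1\<close> by auto
    have "g 0 \<in> e" using edge_eq[OF g(1)] g(2) e by (auto simp: path_image_def)
    then have "g 0 \<noteq> v" if "v \<in> {0, 1}" for v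
      using that ne incident_edge_unique[OF that assms(19)] by auto
    then have "homotopic_lift_in_U0 \<alpha>0 (F m x)"
      using homotopic_lift_in_U0_black[OF \<alpha>0, of g] g by auto
    from itin_monodromy_last[OF p0 this x] show ?thesis unfolding es b .
  qed
  show ?thesis
  proof (intro conjI)
    show "itinerary_monodromy f \<gamma>0 \<gamma>1 \<Lambda> b \<alpha>1 n (es @ [e]) = es @ [edge_monodromy f \<Lambda> b \<alpha>1 1 e]"
      using it1 white by (rule trans)
    \<comment> \<open>Each formula holds under its own equation for e, so the order of the case
      distinction is immaterial.\<close>
    have "e = incident_edge f \<Lambda> 1 \<Longrightarrow> itin (Suc m) (monodromy (F (Suc m)) \<alpha>0 x) = itinerary_monodromy f \<gamma>0 \<gamma>1 \<Lambda> b \<alpha>1 m es @ [e]"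
      and "e = incident_edge f \<Lambda> 0 \<Longrightarrow> itin (Suc m) (monodromy (F (Suc m)) \<alpha>0 x) = itinerary_monodromy f \<gamma>0 \<gamma>1 \<Lambda> b \<alpha>0 m es @ [e]"
      using special[of 1 \<alpha>1] special[of 0 \<alpha>0] \<alpha>0 \<alpha>1 by simp_all
    then show "itinerary_monodromy f \<gamma>0 \<gamma>1 \<Lambda> b \<alpha>0 n (es @ [e]) =
      (if e = incident_edge f \<Lambda> 1 then itinerary_monodromy f \<gamma>0 \<gamma>1 \<Lambda> b \<alpha>1 (n - 1) es @ [e]
       else if e = incident_edge f \<Lambda> 0 then itinerary_monodromy f \<gamma>0 \<gamma>1 \<Lambda> b \<alpha>0 (n - 1) es @ [e]
       else es @ [edge_monodromy f \<Lambda> b \<alpha>0 1 e])"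
      unfolding it0 n(2) using black by presburger
  qed
qed

end
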